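(* Let $G\subset\mathbb{C}^2$ be a pseudoconvex semitube domain. Then there is a sequence $(G_n)_{n\ge1}$ of semitube domains in $\mathbb{C}^2$, each $G_n$ being strongly pseudoconvex with $\mathcal{C}^\infty$-smooth boundary, such that $G_n\subset G_{n+1}\subset G$ for all $n$ and $\bigcup_n G_n=G$.
   Context: Identify $\mathbb{R}^3$ with $\mathbb{C}\times\mathbb{R}$. For a domain $B\subset\mathbb{R}^3$, the semitube domain with base $B$ is $S_B:=\{(z_1,z_2)\in\mathbb{C}^2:(z_1,\operatorname{Re} z_2)\in B\}$. A domain $G\subset\mathbb{C}^2$ is called a semitube domain if $G=S_B$ for some domain $B\subset\mathbb{R}^3$, i.e. $G$ is invariant under translations in the $\operatorname{Im} z_2$ direction. *)

theory Defs
  imports "HOL-Analysis.Analysis"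
begin

definition is_domain :: "'a::topological_space set \<Rightarrow> bool" where
  "is_domain D \<longleftrightarrow> open D \<and> connected D \<and> D \<noteq> {}"

definition semitube :: "(complex \<times> real) set \<Rightarrow> (complex \<times> complex) set" where
  "semitube B = {(z1, z2). (z1, Re z2) \<in> B}"

definition is_semitube_domain :: "(complex \<times> complex) set \<Rightarrow> bool" where
  "is_semitube_domain G \<longleftrightarrow> (\<exists>B. is_domain B \<and> G = semitube B)"

definition cmul :: "complex \<Rightarrow> complex \<times> complex \<Rightarrow> complex \<times> complex" where
  "cmul c z = (c * fst z, c * snd z)"

definition psh_on :: "(complex \<times> complex) set \<Rightarrow> (complex \<times> complex \<Rightarrow> real) \<Rightarrow> bool" where
  "psh_on G u \<longleftrightarrow> continuous_on G u \<and>
     (\<forall>a b. (\<forall>c. norm c \<le> 1 \<longrightarrow> a + cmul c b \<in> G) \<longrightarrow>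
        u a \<le> integral {0..2*pi} (\<lambda>t. u (a + cmul (exp (\<i> * of_real t)) b)) / (2*pi))"

definition pseudoconvex :: "(complex \<times> complex) set \<Rightarrow> bool" where
  "pseudoconvex G \<longleftrightarrow> is_domain G \<and>
     (\<exists>u. psh_on G u \<and> (\<forall>c::real. \<exists>K. compact K \<and> K \<subseteq> G \<and> {z \<in> G. u z < c} \<subseteq> K))"

fun Ck_on :: "nat \<Rightarrow> ('a::real_normed_vector \<Rightarrow> real) \<Rightarrow> 'a set \<Rightarrow> bool" where
  "Ck_on 0 f U = continuous_on U f"
| "Ck_on (Suc k) f U = (\<exists>f'. (\<forall>x\<in>U. (f has_derivative f' x) (at x)) \<and> (\<forall>v. Ck_on k (\<lambda>x. f' x v) U))"

definition smooth_on :: "('a::real_normed_vector \<Rightarrow> real) \<Rightarrow> 'a set \<Rightarrow> bool" where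
  "smooth_on f U \<longleftrightarrow> (\<forall>k. Ck_on k f U)"

definition dir1 :: "(complex \<times> complex \<Rightarrow> real) \<Rightarrow> complex \<times> complex \<Rightarrow> complex \<times> complex \<Rightarrow> real" where
  "dir1 \<rho> p w = deriv (\<lambda>t::real. \<rho> (p + t *\<^sub>R w)) 0"

definition dir2 :: "(complex \<times> complex \<Rightarrow> real) \<Rightarrow> complex \<times> complex \<Rightarrow> complex \<times> complex \<Rightarrow> real" where
  "dir2 \<rho> p w = deriv (deriv (\<lambda>t::real. \<rho> (p + t *\<^sub>R w))) 0"

text \<open>Levi form L_p(w) = sum d^2\<rho>/dz_j d(conj z_k) w_j conj(w_k) = (D^2\<rho>(w,w) + D^2\<rho>(iw,iw))/4.\<close>
definition levi_form :: "(complex \<times> complex \<Rightarrow> real) \<Rightarrow> complex \<times> complex \<Rightarrow> complex \<times> complex \<Rightarrow> real" where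
  "levi_form \<rho> p w = (dir2 \<rho> p w + dir2 \<rho> p (cmul \<i> w)) / 4"

text \<open>Complex tangent space at p: \<partial>\<rho>(p) w = 0, i.e. d\<rho>(p) w = 0 and d\<rho>(p)(iw) = 0.\<close>
definition strongly_pseudoconvex_smooth :: "(complex \<times> complex) set \<Rightarrow> bool" where
  "strongly_pseudoconvex_smooth G \<longleftrightarrow> is_domain G \<and>
     (\<exists>U \<rho>. open U \<and> frontier G \<subseteq> U \<and> smooth_on \<rho> U \<and>
        G \<inter> U = {z \<in> U. \<rho> z < 0} \<and>
        (\<forall>p \<in> frontier G.
           (\<exists>v. dir1 \<rho> p v \<noteq> 0) \<and>
           (\<forall>w. w \<noteq> 0 \<and> dir1 \<rho> p w = 0 \<and> dir1 \<rho> p (cmul \<i> w) = 0 \<longrightarrow> levi_form \<rho> p w > 0)))"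

end

theory Submission
  imports Defs "HOL-Computational_Algebra.Polynomial"
begin

text \<open>
  Let \<open>d\<close> be the distance to the complement of the base \<open>B\<close>. By Oka's theorem \<open>- ln d\<close> is
  plurisubharmonic, and it does not depend on \<open>Im z2\<close>, so \<open>max (- ln d) |x|^2\<close> is an invariant
  exhaustion. Oka's theorem is reduced to a contact argument: if a quadratic disc touched \<open>- ln d\<close>
  from above with negative Laplacian, discs pushed towards the nearest boundary point would have
  their boundaries in a fixed compact set while their centres leave the domain, against the maximum
  principle for the given exhaustion.

  Near a sublevel set, mollify the exhaustion, add a small multiple of \<open>|x|^2\<close> to make it strictly
  plurisubharmonic, and subtract a small linear function. The linear function is a regular value of
  the gradient, so the critical points are nondegenerate, hence finite in number on a compact set,
  and almost every level is regular; only the equidimensional case of Sard's theorem is needed.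
  The domains are the components of such sublevel sets containing a fixed point.
\<close>

section \<open>The maximum principle on quadratic discs\<close>

text \<open>The sublevel sets of the exhaustion \<open>u\<close> given by pseudoconvexity are
  relatively compact in the semitube, whereas a nonempty semitube is unbounded in
  \<open>Im z2\<close>. So \<open>u\<close> cannot produce the domains itself; it only serves to
  exclude contact, and everything afterwards happens on the three-dimensional base.

  The submean inequality is available for a merely continuous function and for affine discs only.
  Oka's argument needs more: the shift towards the boundary must be multiplied by a holomorphic
  factor \<open>exp e\<close>. Its Taylor polynomial of order two is enough, because the contact has
  a quadratic margin and the error is cubic. This is why exactly quadratic discs occur.

  The other obstacle is connectedness. A sublevel set may fall apart, and a boundary point of one
  component might also be approached by another component. Near a regular boundary point any two
  points of the sublevel set can be joined inside it, so there a component is the full sublevel set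
  and has the same defining function. Consecutive levels are 2 apart while all errors together stay
  below 1, which makes the chosen components nested.\<close>

lemma cmul_simps [simp]:
  "cmul 0 b = 0" "cmul c 0 = 0" "cmul 1 b = b" "cmul c (cmul d b) = cmul (c * d) b"
  by (auto simp: cmul_def zero_prod_def mult.assoc)

lemma cmul_add_left: "cmul (c + d) b = cmul c b + cmul d b"
  and cmul_add_right: "cmul c (a + b) = cmul c a + cmul c b"
  and cmul_of_real: "cmul (of_real s) b = s *\<^sub>R b"
  by (auto simp: cmul_def algebra_simps scaleR_conv_of_real prod_eq_iff)

lemma norm_cmul: "norm (cmul c b) = norm c * norm b"
proof -
  have "(norm c * norm (fst b))\<^sup>2 + (norm c * norm (snd b))\<^sup>2
      = (norm c)\<^sup>2 * ((norm (fst b))\<^sup>2 + (norm (snd b))\<^sup>2)"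
    by (simp add: power_mult_distrib distrib_left)
  then show ?thesis
    by (simp add: cmul_def norm_prod_def norm_mult real_sqrt_mult)
qed

lemma continuous_on_cmul [continuous_intros]:
  assumes "continuous_on S f" "continuous_on S g"
  shows "continuous_on S (\<lambda>x. cmul (f x) (g x))"
  unfolding cmul_def by (intro continuous_intros assms)

lemma cmul_cis: "cmul (exp (\<i> * of_real x)) b = cos x *\<^sub>R b + sin x *\<^sub>R cmul \<i> b"
  by (simp add: cmul_def prod_eq_iff exp_Euler scaleR_conv_of_real algebra_simps
      flip: cos_of_real sin_of_real)

lemma has_integral_cos_multiple:
  assumes "n > 0"
  shows "((\<lambda>s. cos (real n * s)) has_integral 0) {0..2*pi}"
proof -
  have "((\<lambda>s. cos (real n * s)) has_integral
      (sin (real n * (2*pi)) / real n - sin (real n * 0) / real n)) {0..2*pi}"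
    by (rule fundamental_theorem_of_calculus)
      (use assms in \<open>auto intro!: derivative_eq_intros
        simp flip: has_real_derivative_iff_has_vector_derivative\<close>)
  moreover have "sin (real n * (2*pi)) = 0"
    using sin_npi[of "2*n"] by (simp add: mult.assoc mult.left_commute)
  ultimately show ?thesis by simp
qed

lemma has_integral_sin_multiple:
  assumes "n > 0"
  shows "((\<lambda>s. sin (real n * s)) has_integral 0) {0..2*pi}"
proof -
  have "((\<lambda>s. sin (real n * s)) has_integral
      (- cos (real n * (2*pi)) / real n - - cos (real n * 0) / real n)) {0..2*pi}"
    by (rule fundamental_theorem_of_calculus)
      (use assms in \<open>auto intro!: derivative_eq_intros
        simp flip: has_real_derivative_iff_has_vector_derivative\<close>)
  moreover have "cos (real n * (2*pi)) = 1"
    using cos_npi[of "2*n"] by (simp add: mult.assoc mult.left_commute)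
  ultimately show ?thesis by simp
qed

text \<open>The case \<open>n = 1\<close> removes first-order terms from circle averages,
  \<open>n = 2\<close> the quadratic coefficient in the maximum principle, and general
  \<open>n\<close> gives the mean value property of polynomials.\<close>

lemma has_integral_linear_circle:
  fixes L :: "complex \<times> complex \<Rightarrow> real"
  assumes "linear L" "n > 0"
  shows "((\<lambda>s. L (cmul (exp (\<i> * of_real (real n * s))) b)) has_integral 0) {0..2*pi}"
proof -
  have "((\<lambda>s. cos (real n * s) * L b + sin (real n * s) * L (cmul \<i> b)) has_integral
      (0 * L b + 0 * L (cmul \<i> b))) {0..2*pi}"
    by (intro has_integral_add has_integral_mult_left has_integral_cos_multiple
        has_integral_sin_multiple assms)
  then show ?thesis
    by (simp add: cmul_cis linear_add[OF assms(1)] linear_scale[OF assms(1)] del: of_real_mult)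
qed

lemma psh_on_submean:
  assumes "psh_on G u" and "\<And>c. norm c \<le> 1 \<Longrightarrow> a + cmul c b \<in> G"
  shows "2 * pi * u a \<le> integral {0..2*pi} (\<lambda>t. u (a + cmul (exp (\<i> * of_real t)) b))"
proof -
  have "u a \<le> integral {0..2*pi} (\<lambda>t. u (a + cmul (exp (\<i> * of_real t)) b)) / (2*pi)"
    using assms unfolding psh_on_def by blast
  then show ?thesis by (simp add: field_simps)
qed


text \<open>
  Plurisubharmonicity is only given on affine discs. The proof maximises
  \<open>u (f l + w) + \<epsilon> |l|^2 - N |w|^2\<close> over \<open>l\<close> in the disc and small \<open>w\<close>: at an interior maximum the
  penalty can be varied along the affine disc tangent to \<open>f\<close>, where \<open>w\<close> only changes by
  \<open>l^2\<close> times \<open>k\<close>, to second order without effect on the mean.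
\<close>

lemma psh_max_principle_quadratic_disc:
  fixes A b k :: "complex \<times> complex"
  defines "f \<equiv> \<lambda>l. A + cmul l b + cmul (l\<^sup>2) k"
  assumes "open G" and psh: "psh_on G u" and "r > 0"
    and inG: "\<And>l. norm l \<le> r \<Longrightarrow> f l \<in> G"
    and bdry: "\<And>l. norm l = r \<Longrightarrow> u (f l) \<le> M"
  shows "u A \<le> M"
proof (rule ccontr)
  assume "\<not> u A \<le> M"
  then have less: "M < u A" by simp
  define g where "g = u A - M"
  have g: "g > 0" using less by (simp add: g_def)
  \<comment> \<open>On the rim the bonus \<open>\<epsilon> * r^2\<close> is \<open>g / 4\<close> and
    \<open>u\<close> exceeds \<open>M\<close> by less than \<open>g / 4\<close> for small
    \<open>w\<close>, so the total stays below \<open>u A = M + g\<close>. A maximum at least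
    \<open>u A\<close> is then not attained on the rim.\<close>
  define \<epsilon> where "\<epsilon> = g / (4 * r\<^sup>2)"
  have \<epsilon>: "\<epsilon> > 0" "\<epsilon> * r\<^sup>2 = g / 4"
    using g \<open>r > 0\<close> by (auto simp: \<epsilon>_def)
  have contf: "continuous_on S f" for S
    unfolding f_def by (intro continuous_intros)
  have "compact (f ` cball 0 r)" "f ` cball 0 r \<subseteq> G"
    using inG by (auto intro!: compact_continuous_image contf)
  then obtain e where e: "e > 0" "(\<Union>x\<in>f ` cball 0 r. ball x e) \<subseteq> G"
    using compact_subset_open_imp_ball_epsilon_subset[OF _ \<open>open G\<close>] by metis
  have inG2: "f l + w \<in> G" if "norm l \<le> r" "norm w < e" for l w
  proof -
    have "f l + w \<in> ball (f l) e" using that by (simp add: dist_norm)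
    then show ?thesis using e(2) that(1) by fastforce
  qed
  have contu: "continuous_on G u" using psh by (simp add: psh_on_def)
  define S0 where "S0 = cball (0::complex) r \<times> cball (0::complex\<times>complex) (e/2)"
  have contH: "continuous_on S0 (\<lambda>x. u (f (fst x) + snd x))"
    by (rule continuous_on_compose2[OF contu])
      (use e(1) in \<open>auto simp: S0_def intro!: continuous_intros inG2
        continuous_on_compose2[OF contf[of UNIV]]\<close>)
  have "compact S0" by (simp add: S0_def compact_Times)
  then have "uniformly_continuous_on S0 (\<lambda>x. u (f (fst x) + snd x))"
    using contH compact_uniformly_continuous by blast
  then obtain \<tau>0 where \<tau>0: "\<tau>0 > 0" "\<And>x y. x \<in> S0 \<Longrightarrow> y \<in> S0 \<Longrightarrow> dist x y < \<tau>0 \<Longrightarrow>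
      dist (u (f (fst x) + snd x)) (u (f (fst y) + snd y)) < g / 4"
    using g unfolding uniformly_continuous_on_def by (metis zero_less_divide_iff zero_less_numeral dist_commute)
  define \<tau> where "\<tau> = min (\<tau>0 / 2) (e / 2)"
  have \<tau>: "\<tau> > 0" "\<tau> < \<tau>0" "\<tau> \<le> e/2" using e \<tau>0 by (auto simp: \<tau>_def)
  have near: "u (f l + w) < M + g / 4" if "norm l = r" "norm w \<le> \<tau>" for l w
  proof -
    have "dist (u (f l + w)) (u (f l + 0)) < g / 4"
      using \<tau>0(2)[of "(l,w)" "(l,0)"] that \<tau> e(1) by (auto simp: S0_def dist_Pair_Pair)
    then show ?thesis using bdry[of l] that unfolding dist_real_def by (simp only: add_0_right) linarith
  qed
  define S where "S = cball (0::complex) r \<times> cball (0::complex\<times>complex) \<tau>"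
  have "S \<subseteq> S0" using \<tau> by (auto simp: S_def S0_def)
  have "compact S" "S \<noteq> {}"
    using \<tau> \<open>r > 0\<close> by (auto simp: S_def compact_Times)
  have contS: "continuous_on S (\<lambda>x. u (f (fst x) + snd x))"
    using contH \<open>S \<subseteq> S0\<close> continuous_on_subset by blast
  then obtain m where m: "\<And>x. x \<in> S \<Longrightarrow> u (f (fst x) + snd x) \<le> m"
    using continuous_attains_sup[OF \<open>compact S\<close> \<open>S \<noteq> {}\<close>] by meson
  \<comment> \<open>For norm \<open>w\<close> equal to \<open>\<tau>\<close> the penalty is
    \<open>\<bar>m\<bar> + g + \<bar>u A\<bar>\<close>, which outweighs the bound \<open>m\<close>
    on \<open>u\<close> and the bonus \<open>g / 4\<close>: the value drops below
    \<open>u A\<close>, so the maximum has \<open>w\<close> in the interior.\<close>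
  define N where "N = (\<bar>m\<bar> + g + \<bar>u A\<bar>) / \<tau>\<^sup>2"
  have N: "N \<ge> 0" "N * \<tau>\<^sup>2 = \<bar>m\<bar> + g + \<bar>u A\<bar>"
    using \<tau> g by (auto simp: N_def)
  define F where "F x = u (f (fst x) + snd x) + \<epsilon> * (norm (fst x))\<^sup>2 - N * (norm (snd x))\<^sup>2" for x
  have "continuous_on S F"
    unfolding F_def by (intro continuous_intros contS)
  then obtain x where x: "x \<in> S" "\<And>y. y \<in> S \<Longrightarrow> F y \<le> F x"
    using continuous_attains_sup[OF \<open>compact S\<close> \<open>S \<noteq> {}\<close>] by meson
  obtain l0 w0 where xeq: "x = (l0, w0)" by (cases x)
  have "F (0,0) = u A" by (simp add: F_def f_def)
  moreover have "(0,0) \<in> S" using \<tau> \<open>r > 0\<close> by (simp add: S_def)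
  ultimately have ge: "u A \<le> F (l0,w0)" using x xeq by metis
  have l0: "norm l0 < r"
  proof (rule ccontr)
    assume "\<not> norm l0 < r"
    then have "norm l0 = r" "norm w0 \<le> \<tau>" using x(1) xeq by (auto simp: S_def)
    then have "u (f l0 + w0) < M + g/4" by (rule near)
    moreover have "N * (norm w0)\<^sup>2 \<ge> 0" using N by simp
    ultimately have "F (l0,w0) < M + g/4 + g/4"
      using \<epsilon>(2) \<open>norm l0 = r\<close> by (simp add: F_def)
    then show False using ge g unfolding g_def by argo
  qed
  have w0: "norm w0 < \<tau>"
  proof (rule ccontr)
    assume "\<not> norm w0 < \<tau>"
    then have eq: "norm w0 = \<tau>" using x(1) xeq by (auto simp: S_def)
    have "\<epsilon> * (norm l0)\<^sup>2 \<le> \<epsilon> * r\<^sup>2"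
      using l0 \<epsilon> by (intro mult_left_mono power_mono) auto
    moreover have "u (f l0 + w0) \<le> m" using m x xeq by fastforce
    ultimately show False using ge eq N(2) \<epsilon>(2) g by (simp add: F_def)
  qed
  \<comment> \<open>This is the derivative of \<open>f\<close> at \<open>l0\<close>. Moving
    \<open>l0\<close> by \<open>l\<close> and \<open>w0\<close> by minus \<open>l^2\<close> times
    \<open>k\<close> cancels the quadratic term of \<open>f\<close>, so the moving point traces an
    affine disc through \<open>z0\<close>.\<close>
  define b' where "b' = b + cmul (2 * l0) k"
  define z0 where "z0 = f l0 + w0"
  \<comment> \<open>The first entry keeps \<open>l0 + l\<close> in the disc, the second and third
    keep the shifted \<open>w0\<close> within \<open>\<tau>\<close>, and the last makes the
    fourth-order penalty smaller than \<open>\<epsilon> * t^2\<close>.\<close>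
  define t where "t = Min {(r - norm l0), 1, (\<tau> - norm w0) / (1 + norm k), sqrt (\<epsilon> / (2 * (N * (norm k)\<^sup>2 + 1)))}"
  have kpos: "N * (norm k)\<^sup>2 + 1 > 0" using N(1) by (smt (verit) mult_nonneg_nonneg zero_le_power2)
  have t: "t > 0" "t \<le> r - norm l0" "t \<le> 1" "t \<le> (\<tau> - norm w0) / (1 + norm k)"
    "t \<le> sqrt (\<epsilon> / (2 * (N * (norm k)\<^sup>2 + 1)))"
    using l0 w0 \<epsilon> kpos by (auto simp: t_def add_pos_nonneg)
  have t2: "N * (norm k)\<^sup>2 * t\<^sup>2 < \<epsilon>"
  proof -
    have "t\<^sup>2 \<le> \<epsilon> / (2 * (N * (norm k)\<^sup>2 + 1))"
      using t(1,5) \<epsilon> kpos real_le_rsqrt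
      by (metis abs_of_pos real_sqrt_abs real_sqrt_le_iff)
    then have "t\<^sup>2 * (2 * (N * (norm k)\<^sup>2 + 1)) \<le> \<epsilon>"
      using kpos by (simp add: field_simps)
    then have "2 * (N * (norm k)\<^sup>2 * t\<^sup>2) + 2 * t\<^sup>2 \<le> \<epsilon>"
      by (simp add: algebra_simps)
    moreover have "t\<^sup>2 > 0" "N * (norm k)\<^sup>2 * t\<^sup>2 \<ge> 0" using t N by auto
    ultimately show ?thesis by linarith
  qed
  have step: "(l0 + l, w0 - cmul (l\<^sup>2) k) \<in> S" if "norm l \<le> t" for l
  proof -
    have "norm (l0 + l) \<le> r" using norm_triangle_ineq[of l0 l] that t by linarith
    moreover have "norm (w0 - cmul (l\<^sup>2) k) \<le> norm w0 + t\<^sup>2 * norm k"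
    proof -
      have "norm (cmul (l\<^sup>2) k) \<le> t\<^sup>2 * norm k"
        using that by (auto simp: norm_cmul norm_power intro!: mult_right_mono power_mono)
      then show ?thesis using norm_triangle_ineq4[of w0 "cmul (l\<^sup>2) k"] by linarith
    qed
    moreover have "t\<^sup>2 * norm k \<le> t * (1 + norm k)"
    proof -
      have "t * norm k \<le> 1 * norm k" using t by (intro mult_right_mono) auto
      then have "t * (t * norm k) \<le> t * (1 + norm k)" using t by (intro mult_left_mono) auto
      then show ?thesis by (simp add: power2_eq_square mult.assoc)
    qed
    moreover have "t * (1 + norm k) \<le> \<tau> - norm w0"
      using t(4) by (simp add: pos_le_divide_eq add_pos_nonneg)
    ultimately show ?thesis by (simp add: S_def)
  qed
  have shift: "f (l0 + l) + (w0 - cmul (l\<^sup>2) k) = z0 + cmul l b'" for l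
    by (simp add: f_def z0_def b'_def power2_sum cmul_add_left cmul_add_right algebra_simps)
  \<comment> \<open>The two inner products have mean zero on the circle. What remains of the average
    is \<open>u z0\<close> minus a positive amount, against the submean inequality at
    \<open>z0\<close>.\<close>
  have bound: "u (z0 + cmul l b') \<le> u z0 - \<epsilon> * t\<^sup>2 + N * t^4 * (norm k)\<^sup>2
      - 2 * \<epsilon> * inner l0 l - 2 * N * inner w0 (cmul (l\<^sup>2) k)" if "norm l = t" for l
  proof -
    have "F (l0 + l, w0 - cmul (l\<^sup>2) k) \<le> F (l0, w0)"
      using x(2)[OF step] that xeq by simp
    then have "u (z0 + cmul l b') + \<epsilon> * (norm (l0 + l))\<^sup>2 - N * (norm (w0 - cmul (l\<^sup>2) k))\<^sup>2
        \<le> u z0 + \<epsilon> * (norm l0)\<^sup>2 - N * (norm w0)\<^sup>2"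
      using shift by (simp add: F_def z0_def)
    moreover have "(norm (l0 + l))\<^sup>2 = (norm l0)\<^sup>2 + 2 * inner l0 l + t\<^sup>2"
      using that by (simp add: power2_norm_eq_inner inner_add inner_commute flip: that)
    moreover have "(norm (w0 - cmul (l\<^sup>2) k))\<^sup>2 = (norm w0)\<^sup>2 - 2 * inner w0 (cmul (l\<^sup>2) k) + (t\<^sup>2 * norm k)\<^sup>2"
    proof -
      have "(norm (cmul (l\<^sup>2) k))\<^sup>2 = (t\<^sup>2 * norm k)\<^sup>2"
        using that by (simp add: norm_cmul norm_power)
      then show ?thesis
        by (simp add: power2_norm_eq_inner inner_diff inner_commute)
    qed
    ultimately show ?thesis by (simp add: algebra_simps power_mult_distrib flip: power_mult)
  qed
  let ?c = "\<lambda>s. exp (\<i> * of_real s) :: complex"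
  have int1: "((\<lambda>s. inner l0 (of_real t * ?c s)) has_integral 0) {0..2*pi}"
  proof -
    have "linear (\<lambda>z. inner l0 (of_real t * fst z))"
      by (rule linearI) (auto simp: inner_complex_def algebra_simps)
    from has_integral_linear_circle[OF this, of 1 "(1,0)"] show ?thesis by (simp add: cmul_def)
  qed
  have int2: "((\<lambda>s. inner w0 (cmul ((of_real t * ?c s)\<^sup>2) k)) has_integral 0) {0..2*pi}"
  proof -
    have "linear (\<lambda>z. inner w0 z)"
      by (rule linearI) (auto simp: inner_add)
    from has_integral_linear_circle[OF this, of 2 "cmul (of_real (t\<^sup>2)) k"] show ?thesis
      by (simp add: power_mult_distrib exp_double power2_eq_square algebra_simps exp_add[symmetric])
  qed
  have int: "((\<lambda>s. u z0 - \<epsilon> * t\<^sup>2 + N * t^4 * (norm k)\<^sup>2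
      - 2 * \<epsilon> * inner l0 (of_real t * ?c s) - 2 * N * inner w0 (cmul ((of_real t * ?c s)\<^sup>2) k))
      has_integral (2 * pi * (u z0 - \<epsilon> * t\<^sup>2 + N * t^4 * (norm k)\<^sup>2) - 2 * \<epsilon> * 0 - 2 * N * 0)) {0..2*pi}"
    using has_integral_const_real[of "u z0 - \<epsilon> * t\<^sup>2 + N * t^4 * (norm k)\<^sup>2" 0 "2*pi"]
    by (intro has_integral_diff has_integral_mult_right int1 int2) simp
  have disc: "z0 + cmul l b' \<in> G" if "norm l \<le> t" for l
  proof -
    have "norm (l0 + l) \<le> r" "norm (w0 - cmul (l\<^sup>2) k) < e"
      using step[OF that] \<tau> e(1) by (auto simp: S_def)
    then show ?thesis using inG2 shift by metis
  qed
  have cint: "(\<lambda>s. u (z0 + cmul (?c s) (cmul (of_real t) b'))) integrable_on {0..2*pi}"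
    by (rule integrable_continuous_real, rule continuous_on_compose2[OF contu])
      (use t in \<open>auto intro!: continuous_intros disc simp: norm_mult\<close>)
  have "2 * pi * u z0 \<le> integral {0..2*pi} (\<lambda>s. u (z0 + cmul (?c s) (cmul (of_real t) b')))"
    by (rule psh_on_submean[OF psh]) (use t disc in \<open>auto simp: norm_mult mult_left_le_one_le\<close>)
  also have "\<dots> \<le> 2 * pi * (u z0 - \<epsilon> * t\<^sup>2 + N * t^4 * (norm k)\<^sup>2) - 2 * \<epsilon> * 0 - 2 * N * 0"
    by (rule has_integral_le[OF integrable_integral[OF cint] int])
      (use bound[of "of_real t * ?c _"] t in \<open>auto simp: norm_mult mult.commute\<close>)
  finally have "2 * pi * u z0 \<le> 2 * pi * (u z0 - \<epsilon> * t\<^sup>2 + N * t^4 * (norm k)\<^sup>2)" by simp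
  then have "\<epsilon> * t\<^sup>2 \<le> N * t^4 * (norm k)\<^sup>2" by simp
  moreover have "N * t^4 * (norm k)\<^sup>2 = (N * (norm k)\<^sup>2 * t\<^sup>2) * t\<^sup>2" by (simp add: power4_eq_xxxx power2_eq_square)
  moreover have "(N * (norm k)\<^sup>2 * t\<^sup>2) * t\<^sup>2 < \<epsilon> * t\<^sup>2"
    using t2 t by (intro mult_strict_right_mono) auto
  ultimately show False by simp
qed

section \<open>Plurisubharmonicity of the logarithmic boundary distance\<close>

definition base_proj :: "complex \<times> complex \<Rightarrow> complex \<times> real" where
  "base_proj z = (fst z, Re (snd z))"

definition base_lift :: "complex \<times> real \<Rightarrow> complex \<times> complex" where
  "base_lift x = (fst x, of_real (snd x))"

lemma semitube_iff: "z \<in> semitube B \<longleftrightarrow> base_proj z \<in> B"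
  by (cases z) (simp add: semitube_def base_proj_def)

lemma bounded_linear_base_proj: "bounded_linear base_proj"
  unfolding base_proj_def
  by (intro bounded_linear_Pair bounded_linear_fst
      bounded_linear_compose[OF bounded_linear_Re bounded_linear_snd])

lemma linear_base_proj: "linear base_proj"
  using bounded_linear_base_proj by (rule bounded_linear.linear)

lemmas base_proj_add = linear_add[OF linear_base_proj]
  and base_proj_scaleR = linear_scale[OF linear_base_proj]
  and base_proj_0 [simp] = linear_0[OF linear_base_proj]

lemmas continuous_on_base_proj [continuous_intros] =
  bounded_linear.continuous_on[OF bounded_linear_base_proj]

lemma norm_base_proj_le: "norm (base_proj z) \<le> norm z"
  by (auto simp: base_proj_def norm_prod_def abs_Re_le_cmod
      intro!: real_sqrt_le_mono add_left_mono power2_le_iff_abs_le[THEN iffD2])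

lemma base_lift [simp]: "base_proj (base_lift x) = x" "norm (base_lift x) = norm x"
  by (auto simp: base_proj_def base_lift_def norm_prod_def)

lemma base_lift_diff: "base_lift (x - y) = base_lift x - base_lift y"
  by (simp add: base_lift_def)

lemma mem_if_dist_less_infdist: "dist x y < infdist x (- B) \<Longrightarrow> y \<in> B"
  using infdist_le[of y "- B" x] by auto

lemma infdist_Compl_pos:
  assumes "open B" "x \<in> B" "- B \<noteq> {}"
  shows "infdist x (- B) > 0"
  using assms in_closed_iff_infdist_zero[of "- B" x] infdist_nonneg[of x "- B"] by fastforce

text \<open>The disc over \<open>p\<close> is pushed by \<open>s\<close> times
  \<open>1 + c1 l + c2 l^2\<close> along \<open>k\<close>, the vector from \<open>p\<close> to the
  nearest outside point \<open>q\<close>. By \<open>contact\<close> the push is shorter than the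
  available distance, so the closed discs stay inside, apart from the centre at
  \<open>s = 1\<close>, which is \<open>q\<close>. Their rims for all \<open>s\<close> form one
  compact set, so the maximum principle bounds \<open>u\<close> at the centres for
  \<open>s < 1\<close>; the exhaustion confines these to a compact subset of the semitube although
  they converge to \<open>q\<close>.\<close>

lemma no_quadratic_contact:
  assumes psc: "pseudoconvex (semitube B)" and "p \<in> B" "q \<notin> B"
    and pq: "dist p q = infdist p (- B)" and "r > 0"
    and contact: "\<And>l. 0 < norm l \<Longrightarrow> norm l \<le> r \<Longrightarrow>
      infdist p (- B) * norm (1 + c1 * l + c2 * l\<^sup>2) < infdist (p + base_proj (cmul l b)) (- B)"
  shows False
proof -
  let ?G = "semitube B"
  obtain u where u: "psh_on ?G u" and exh: "\<And>c. \<exists>K. compact K \<and> K \<subseteq> ?G \<and> {z \<in> ?G. u z < c} \<subseteq> K"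
    using psc unfolding pseudoconvex_def by blast
  have "open ?G" using psc unfolding pseudoconvex_def is_domain_def by simp
  define k where "k = base_lift (q - p)"
  have nk: "norm k = infdist p (- B)" using pq by (simp add: k_def dist_norm norm_minus_commute)
  have dpos: "infdist p (- B) > 0"
    unfolding pq[symmetric] using \<open>p \<in> B\<close> \<open>q \<notin> B\<close> by auto
  define F where "F s l = base_lift p + cmul l b + cmul (of_real s * (1 + c1 * l + c2 * l\<^sup>2)) k" for s l
  have FG: "F s l \<in> ?G" if "0 \<le> s" "s \<le> 1" "norm l \<le> r" "s < 1 \<or> l \<noteq> 0" for s l
  proof -
    have "norm (cmul (of_real s * (1 + c1 * l + c2 * l\<^sup>2)) k) < infdist (p + base_proj (cmul l b)) (- B)"
    proof (cases "l = 0")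
      case True
      then show ?thesis using that nk dpos by (simp add: norm_cmul)
    next
      case False
      have "s * (norm (1 + c1 * l + c2 * l\<^sup>2) * norm k) \<le> 1 * (norm (1 + c1 * l + c2 * l\<^sup>2) * norm k)"
        using that by (intro mult_right_mono) auto
      also have "\<dots> < infdist (p + base_proj (cmul l b)) (- B)"
        using contact[of l] False that nk by (simp add: mult.commute)
      finally show ?thesis using that by (simp add: norm_cmul norm_mult mult.assoc)
    qed
    then have "dist (p + base_proj (cmul l b)) (base_proj (F s l)) < infdist (p + base_proj (cmul l b)) (- B)"
      using norm_base_proj_le[of "cmul (of_real s * (1 + c1 * l + c2 * l\<^sup>2)) k"]
      by (simp add: F_def base_proj_add dist_norm)
    then show ?thesis unfolding semitube_iff by (rule mem_if_dist_less_infdist)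
  qed
  define K where "K = (\<lambda>x. F (fst x) (snd x)) ` ({0..1} \<times> sphere 0 r)"
  have "compact K" unfolding K_def F_def
    by (intro compact_continuous_image continuous_intros compact_Times) auto
  moreover have "K \<subseteq> ?G" using \<open>r > 0\<close> by (auto simp: K_def intro!: FG)
  moreover have "continuous_on ?G u" using u by (simp add: psh_on_def)
  ultimately have "compact (u ` K)"
    using compact_continuous_image continuous_on_subset by blast
  then have "bdd_above (u ` K)" by (intro bounded_imp_bdd_above compact_imp_bounded)
  then obtain M where M: "\<And>z. z \<in> K \<Longrightarrow> u z \<le> M" by (auto simp: bdd_above_def)
  have le: "u (base_lift p + s *\<^sub>R k) \<le> M" if s: "0 \<le> s" "s < 1" for s
  proof (rule psh_max_principle_quadratic_disc[OF \<open>open ?G\<close> u \<open>r > 0\<close>])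
    fix l :: complex
    have eq: "base_lift p + s *\<^sub>R k + cmul l (b + cmul (of_real s * c1) k) + cmul (l\<^sup>2) (cmul (of_real s * c2) k) = F s l"
      by (simp add: F_def cmul_add_left cmul_add_right algebra_simps cmul_of_real)
    show "norm l \<le> r \<Longrightarrow> base_lift p + s *\<^sub>R k + cmul l (b + cmul (of_real s * c1) k)
        + cmul (l\<^sup>2) (cmul (of_real s * c2) k) \<in> ?G"
      unfolding eq using s by (intro FG) auto
    assume "norm l = r"
    then have "F s l \<in> K" using s unfolding K_def by (intro image_eqI[of _ _ "(s,l)"]) auto
    then show "u (base_lift p + s *\<^sub>R k + cmul l (b + cmul (of_real s * c1) k)
        + cmul (l\<^sup>2) (cmul (of_real s * c2) k)) \<le> M"
      unfolding eq by (rule M)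
  qed
  \<comment> \<open>The centres satisfy \<open>u \<le> M\<close>, but the exhaustion speaks of
    strict sublevel sets, hence \<open>M + 1\<close>.\<close>
  obtain K' where K': "compact K'" "K' \<subseteq> ?G" "{z \<in> ?G. u z < M + 1} \<subseteq> K'"
    using exh[of "M + 1"] by blast
  define s where "s n = 1 - inverse (real (Suc n))" for n
  have s: "0 \<le> s n" "s n < 1" for n by (auto simp: s_def field_simps)
  have inK: "base_lift p + s n *\<^sub>R k \<in> K'" for n
  proof -
    have "F (s n) 0 \<in> ?G" using s[of n] \<open>r > 0\<close> by (intro FG) auto
    then show ?thesis using le[OF s, of n] K'(3) by (auto simp: F_def cmul_of_real)
  qed
  have "s \<longlonglongrightarrow> 1 - 0" unfolding s_def by (intro tendsto_intros LIMSEQ_inverse_real_of_nat)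
  then have "(\<lambda>n. base_lift p + s n *\<^sub>R k) \<longlonglongrightarrow> base_lift p + (1 - 0) *\<^sub>R k"
    by (intro tendsto_intros)
  then have "base_lift p + (1 - 0) *\<^sub>R k \<in> K'"
    by (rule closed_sequentially[OF compact_imp_closed[OF K'(1)] inK])
  then have "base_lift q \<in> ?G" using K'(2) by (auto simp: k_def base_lift_diff)
  then show False using \<open>q \<notin> B\<close> by (simp add: semitube_iff)
qed

text \<open>Replaces the exponential multiplier, which arises naturally at a contact point, by the
  quadratic one that the maximum principle can handle. Each derivative of \<open>exp\<close> of a
  polynomial is a polynomial times the same exponential; \<open>Q\<close> is the recursion for these
  factors, and a bound on the third derivative over the closed unit disc controls the error.\<close>

lemma exp_poly_Taylor2:
  fixes e :: "complex poly"
  assumes "poly e 0 = 0"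
  obtains c1 c2 C where "C \<ge> 0"
    "\<And>l. norm l \<le> 1 \<Longrightarrow> norm (exp (poly e l) - (1 + c1 * l + c2 * l\<^sup>2)) \<le> C * norm l ^ 3"
proof -
  define Q where "Q = rec_nat (1::complex poly) (\<lambda>_ q. pderiv q + q * pderiv e)"
  define f where "f i l = poly (Q i) l * exp (poly e l)" for i l
  have der: "(f i has_field_derivative f (Suc i) x) (at x within S)" for i x S
    unfolding f_def Q_def
    by (rule has_field_derivative_at_within)
      (auto intro!: derivative_eq_intros poly_DERIV simp: algebra_simps)
  have "continuous_on (cball 0 1) (f 3)"
    unfolding f_def by (intro continuous_intros)
  then have "compact (f 3 ` cball 0 1)" by (intro compact_continuous_image) auto
  then obtain C where C: "\<And>x. x \<in> cball 0 1 \<Longrightarrow> norm (f 3 x) \<le> C"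
    using compact_imp_bounded bounded_iff by (metis imageI)
  have "norm (exp (poly e l) - (1 + f 1 0 * l + f 2 0 / 2 * l\<^sup>2)) \<le> (C / 2) * norm l ^ 3"
    if "norm l \<le> 1" for l
  proof -
    have "norm (f 0 l - (\<Sum>i\<le>2. f i 0 * (l - 0) ^ i / fact i)) \<le> C * norm (l - 0) ^ Suc 2 / fact 2"
      by (rule complex_Taylor[where S = "cball 0 1"])
        (use that C in \<open>auto simp: der numeral_3_eq_3 numeral_2_eq_2\<close>)
    then show ?thesis
      using assms by (simp add: numeral_2_eq_2 numeral_3_eq_3 f_def[of 0] Q_def algebra_simps)
  qed
  moreover have "C / 2 \<ge> 0" using order_trans[OF norm_ge_zero C[of 0]] by simp
  ultimately show thesis using that by blast
qed

text \<open>Comparison with a harmonic function on an affine disc. If it fails at the centre, the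
  difference plus \<open>\<epsilon>\<close> times the squared modulus has an interior maximum at
  some \<open>l0\<close>. There the distance grows at least like the modulus of \<open>exp e\<close>
  times \<open>1 + \<epsilon>\<close> times the squared modulus of \<open>m\<close>; this quadratic
  surplus beats the cubic Taylor error and yields the forbidden contact.\<close>

lemma minus_ln_infdist_le_Re_poly:
  assumes psc: "pseudoconvex (semitube B)" and "open B" and ne: "- B \<noteq> {}"
    and disc: "\<And>l. norm l \<le> 1 \<Longrightarrow> x + base_proj (cmul l b) \<in> B"
    and bdry: "\<And>l. norm l = 1 \<Longrightarrow> - ln (infdist (x + base_proj (cmul l b)) (- B)) \<le> Re (poly P l)"
  shows "- ln (infdist x (- B)) \<le> Re (poly P 0)"
proof (rule ccontr)
  assume asm: "\<not> - ln (infdist x (- B)) \<le> Re (poly P 0)"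
  define d where "d y = infdist y (- B)" for y
  have dpos: "d y > 0" if "y \<in> B" for y
    using infdist_Compl_pos[OF \<open>open B\<close> that ne] by (simp add: d_def)
  have contd: "continuous_on S d" for S unfolding d_def by (intro continuous_intros)
  define h where "h l = - ln (d (x + base_proj (cmul l b))) - Re (poly P l)" for l
  have h0: "h 0 > 0" using asm by (simp add: h_def d_def)
  \<comment> \<open>On the unit circle \<open>h \<le> 0\<close>, so the penalised function is at
    most \<open>\<epsilon>\<close> there, less than its value \<open>2 * \<epsilon>\<close> at the
    centre.\<close>
  define \<epsilon> where "\<epsilon> = h 0 / 2"
  have \<epsilon>: "\<epsilon> > 0" "h 0 = 2 * \<epsilon>" using h0 by (auto simp: \<epsilon>_def)
  have dnz: "d (x + base_proj (cmul l b)) \<noteq> 0" if "norm l \<le> 1" for l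
    using dpos[OF disc[OF that]] by simp
  have conth: "continuous_on (cball 0 1) (\<lambda>l. h l + \<epsilon> * (norm l)\<^sup>2)"
    unfolding h_def
    by (intro continuous_intros continuous_on_compose2[OF contd[of UNIV]]) (auto simp: dnz)
  obtain l0 where "l0 \<in> cball 0 1"
    and max: "\<forall>l\<in>cball 0 1. h l + \<epsilon> * (norm l)\<^sup>2 \<le> h l0 + \<epsilon> * (norm l0)\<^sup>2"
    using continuous_attains_sup[OF compact_cball _ conth] by auto
  then have l0: "norm l0 \<le> 1" "\<And>l. norm l \<le> 1 \<Longrightarrow> h l + \<epsilon> * (norm l)\<^sup>2 \<le> h l0 + \<epsilon> * (norm l0)\<^sup>2"
    by (simp_all add: mem_cball_0)
  have "norm l0 \<noteq> 1"
  proof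
    assume 1: "norm l0 = 1"
    then have "h l0 \<le> 0" using bdry[of l0] by (simp add: h_def d_def)
    then show False using l0(2)[of 0] 1 \<epsilon> by simp
  qed
  then have l01: "norm l0 < 1" using l0 by simp
  define p where "p = x + base_proj (cmul l0 b)"
  have pB: "p \<in> B" using disc l0 by (simp add: p_def)
  \<comment> \<open>The real part of the term with \<open>cnj l0\<close> is the first-order part of
    \<open>\<epsilon>\<close> times the squared modulus at \<open>l0 + m\<close>. Being the real
    part of a holomorphic function, it can be moved into the exponent, and only the squared modulus
    of \<open>m\<close> remains outside.\<close>
  define e where "e = [:poly P l0, of_real (2 * \<epsilon>) * cnj l0:] - pcompose P [:l0, 1:]"
  have e: "poly e m = poly P l0 + of_real (2 * \<epsilon>) * cnj l0 * m - poly P (l0 + m)" for m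
    by (simp add: e_def poly_pcompose mult.commute)
  have lower: "d p * norm (exp (poly e m)) * (1 + \<epsilon> * (norm m)\<^sup>2) \<le> d (p + base_proj (cmul m b))"
    if "norm m \<le> 1 - norm l0" for m
  proof -
    have n: "norm (l0 + m) \<le> 1" using norm_triangle_ineq[of l0 m] that by linarith
    have peq: "x + base_proj (cmul (l0 + m) b) = p + base_proj (cmul m b)"
      by (simp add: p_def cmul_add_left base_proj_add add.assoc)
    have inB: "p + base_proj (cmul m b) \<in> B" using disc[OF n] peq by simp
    have "(norm (l0 + m))\<^sup>2 = (norm l0)\<^sup>2 + 2 * Re (cnj l0 * m) + (norm m)\<^sup>2"
      unfolding cmod_power2 by (simp add: power2_eq_square algebra_simps)
    with l0(2)[OF n] have "ln (d p) + Re (poly e m) + \<epsilon> * (norm m)\<^sup>2 \<le> ln (d (p + base_proj (cmul m b)))"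
      unfolding h_def peq p_def[symmetric] e by (simp add: algebra_simps)
    then have "exp (ln (d p) + Re (poly e m) + \<epsilon> * (norm m)\<^sup>2) \<le> exp (ln (d (p + base_proj (cmul m b))))"
      by (rule exp_le_cancel_iff[THEN iffD2])
    then have "exp (ln (d p) + Re (poly e m) + \<epsilon> * (norm m)\<^sup>2) \<le> d (p + base_proj (cmul m b))"
      unfolding exp_ln[OF dpos[OF inB]] .
    then have "d p * norm (exp (poly e m)) * exp (\<epsilon> * (norm m)\<^sup>2) \<le> d (p + base_proj (cmul m b))"
      using dpos[OF pB] by (simp add: exp_add)
    moreover have "d p * norm (exp (poly e m)) * (1 + \<epsilon> * (norm m)\<^sup>2) \<le> d p * norm (exp (poly e m)) * exp (\<epsilon> * (norm m)\<^sup>2)"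
      using dpos[OF pB] by (intro mult_left_mono exp_ge_add_one_self) auto
    ultimately show ?thesis by linarith
  qed
  have "poly e 0 = 0" by (simp add: e)
  obtain c1 c2 C where C: "C \<ge> 0"
    "\<And>l. norm l \<le> 1 \<Longrightarrow> norm (exp (poly e l) - (1 + c1 * l + c2 * l\<^sup>2)) \<le> C * norm l ^ 3"
    using exp_poly_Taylor2[OF \<open>poly e 0 = 0\<close>] by metis
  have "isCont (\<lambda>m. norm (exp (poly e m))) 0" by (intro continuous_intros)
  then have "(\<lambda>m. norm (exp (poly e m))) \<midarrow>0\<rightarrow> 1"
    using \<open>poly e 0 = 0\<close> by (simp add: isCont_def)
  then have "\<forall>\<^sub>F m in at 0. norm (exp (poly e m)) > 1/2"
    by (rule order_tendstoD) simp
  then obtain r0 where r0: "r0 > 0" "\<And>m. m \<noteq> 0 \<Longrightarrow> norm m < r0 \<Longrightarrow> norm (exp (poly e m)) > 1/2"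
    unfolding eventually_at dist_norm by auto
  \<comment> \<open>The radius keeps \<open>l0 + m\<close> in the unit disc, keeps the modulus of
    \<open>exp e\<close> above 1/2, and forces \<open>C\<close> times the modulus of
    \<open>m\<close> below \<open>\<epsilon> / 2\<close>; \<open>C + 1\<close> guards against
    \<open>C = 0\<close>.\<close>
  define r where "r = Min {1 - norm l0, r0 / 2, \<epsilon> / (2 * (C + 1))}"
  have r: "r > 0" "r \<le> 1 - norm l0" "r < r0" "r \<le> \<epsilon> / (2 * (C + 1))"
  proof -
    have "\<epsilon> / (2 * (C + 1)) > 0" using \<epsilon> C(1) by (intro divide_pos_pos) auto
    then show "r > 0" using l01 r0(1) by (simp add: r_def del: zero_less_divide_iff)
    have "r \<le> r0 / 2" unfolding r_def by (rule Min_le) auto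
    then show "r < r0" using r0(1) by linarith
    show "r \<le> 1 - norm l0" unfolding r_def by (rule Min_le) auto
    show "r \<le> \<epsilon> / (2 * (C + 1))" unfolding r_def by (rule Min_le) auto
  qed
  obtain q where q: "q \<in> - B" "infdist p (- B) = dist p q"
    using infdist_attains_inf[OF closed_Compl[OF \<open>open B\<close>] ne, of p] by blast
  have "q \<notin> B" using q by simp
  show False
  proof (rule no_quadratic_contact[OF psc pB \<open>q \<notin> B\<close> q(2)[symmetric] r(1)])
    fix m :: complex assume m: "0 < norm m" "norm m \<le> r"
    define E where "E = norm (exp (poly e m))"
    have "E > 1/2" using r0(2)[of m] m r by (auto simp: E_def)
    have "norm (1 + c1 * m + c2 * m\<^sup>2) \<le> E + C * norm m ^ 3"
      using C(2)[of m] m r norm_triangle_ineq3[of "exp (poly e m)" "1 + c1 * m + c2 * m\<^sup>2"]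
        norm_ge_zero[of l0] unfolding E_def by linarith
    also have "\<dots> < E * (1 + \<epsilon> * (norm m)\<^sup>2)"
    proof -
      have "norm m \<le> \<epsilon> / (2 * (C + 1))" using m r by simp
      then have "norm m * (2 * (C + 1)) \<le> \<epsilon>" using C(1) by (simp add: pos_le_divide_eq)
      then have "2 * (C * norm m) + 2 * norm m \<le> \<epsilon>" by (simp add: algebra_simps)
      then have "C * norm m < \<epsilon> / 2" using m(1) by linarith
      also have "\<epsilon> / 2 < E * \<epsilon>" using \<open>E > 1/2\<close> \<epsilon> by simp
      finally have "(C * norm m) * (norm m)\<^sup>2 < (E * \<epsilon>) * (norm m)\<^sup>2"
        using m by (intro mult_strict_right_mono) auto
      then show ?thesis by (simp add: algebra_simps power2_eq_square power3_eq_cube)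
    qed
    finally have "d p * norm (1 + c1 * m + c2 * m\<^sup>2) < d p * (E * (1 + \<epsilon> * (norm m)\<^sup>2))"
      using dpos[OF pB] by simp
    also have "\<dots> \<le> d (p + base_proj (cmul m b))"
      using lower[of m] m r by (simp add: E_def mult.assoc)
    finally show "infdist p (- B) * norm (1 + c1 * m + c2 * m\<^sup>2) < infdist (p + base_proj (cmul m b)) (- B)"
      by (simp add: d_def)
  qed
qed

section \<open>Real parts of polynomials on the unit circle\<close>

text \<open>The product of real parts is half the real part of \<open>P Q\<close> plus
  \<open>P\<close> times the conjugate of \<open>Q\<close>. On the circle
  \<open>l * cnj l = 1\<close>, so peeling constant coefficients off both polynomials lowers the
  degrees in the mixed product while each remainder is again the real part of a polynomial.\<close>

lemma Re_poly_mult_on_circle: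
  fixes P Q :: "complex poly"
  shows "\<exists>R. \<forall>l. norm l = 1 \<longrightarrow> Re (poly P l) * Re (poly Q l) = Re (poly R l)"
proof -
  have cnj: "\<exists>R. \<forall>l. norm l = 1 \<longrightarrow> Re (poly P l * cnj (poly Q l)) = Re (poly R l)" for P Q :: "complex poly"
  proof (induction P arbitrary: Q)
    case 0
    show ?case by (intro exI[of _ 0]) simp
  next
    case (pCons a P Q)
    obtain c Q' where Q: "Q = pCons c Q'" by (cases Q)
    obtain R where R: "\<And>l. norm l = 1 \<Longrightarrow> Re (poly P l * cnj (poly Q' l)) = Re (poly R l)"
      using pCons.IH by blast
    have "Re (poly (pCons a P) l * cnj (poly Q l))
        = Re (poly (smult (cnj a) Q + smult (cnj c) (pCons 0 P) + R) l)" if "norm l = 1" for l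
    proof -
      have "l * cnj l = 1" using that by (simp add: complex_norm_square[symmetric])
      then have "poly (pCons a P) l * cnj (poly Q l)
          = a * cnj (poly Q l) + cnj c * l * poly P l + poly P l * cnj (poly Q' l)"
        by (simp add: Q algebra_simps)
      moreover have "Re (a * cnj (poly Q l)) = Re (cnj a * poly Q l)" by simp
      ultimately show ?thesis using R[OF that] by (simp add: algebra_simps)
    qed
    then show ?case by blast
  qed
  obtain R where R: "\<And>l. norm l = 1 \<Longrightarrow> Re (poly P l * cnj (poly Q l)) = Re (poly R l)"
    using cnj by blast
  have "Re (poly P l) * Re (poly Q l) = Re (poly (smult (1/2) (P * Q + R)) l)" if "norm l = 1" for l
    using R[OF that] by (simp add: field_simps)
  then show ?thesis by blast
qed

text \<open>Stone-Weierstrass for the algebra of these real parts. Such an approximation of boundary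
  values comes with a harmonic extension to the disc, which stands in for solving the Dirichlet
  problem.\<close>

lemma circle_approx_Re_poly:
  fixes f :: "complex \<Rightarrow> real"
  assumes "continuous_on (sphere 0 1) f" "e > 0"
  obtains P where "\<And>l. norm l = 1 \<Longrightarrow> \<bar>f l - Re (poly P l)\<bar> < e"
proof -
  interpret function_ring_on "{f. \<exists>P. \<forall>l. norm l = 1 \<longrightarrow> f l = Re (poly P l)}" "sphere (0::complex) 1"
  proof
    fix f :: "complex \<Rightarrow> real" assume "f \<in> {f. \<exists>P. \<forall>l. norm l = 1 \<longrightarrow> f l = Re (poly P l)}"
    then obtain P where "\<And>l. norm l = 1 \<Longrightarrow> f l = Re (poly P l)" by blast
    then show "continuous_on (sphere 0 1) f"
      using continuous_on_cong[of "sphere 0 1" "sphere 0 1" f "\<lambda>l. Re (poly P l)"]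
      by (auto intro!: continuous_intros)
  next
    fix f g :: "complex \<Rightarrow> real"
    assume f: "f \<in> {f. \<exists>P. \<forall>l. norm l = 1 \<longrightarrow> f l = Re (poly P l)}"
      and g: "g \<in> {f. \<exists>P. \<forall>l. norm l = 1 \<longrightarrow> f l = Re (poly P l)}"
    then obtain P Q where PQ: "\<And>l. norm l = 1 \<Longrightarrow> f l = Re (poly P l)" "\<And>l. norm l = 1 \<Longrightarrow> g l = Re (poly Q l)"
      by blast
    then show "(\<lambda>x. f x + g x) \<in> {f. \<exists>P. \<forall>l. norm l = 1 \<longrightarrow> f l = Re (poly P l)}"
      by (auto intro!: exI[of _ "P + Q"])
    show "(\<lambda>x. f x * g x) \<in> {f. \<exists>P. \<forall>l. norm l = 1 \<longrightarrow> f l = Re (poly P l)}"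
      using PQ Re_poly_mult_on_circle[of P Q] by auto
  next
    show "(\<lambda>_. c) \<in> {f. \<exists>P. \<forall>l. norm l = 1 \<longrightarrow> f l = Re (poly P l)}" for c
      by (auto intro!: exI[of _ "[:of_real c:]"])
  next
    fix x y :: complex assume "x \<noteq> y"
    then have "Re x \<noteq> Re y \<or> Im x \<noteq> Im y" by (simp add: complex_eq_iff)
    moreover have "Re \<in> {f. \<exists>P. \<forall>l. norm l = 1 \<longrightarrow> f l = Re (poly P l)}"
      by (auto intro!: exI[of _ "[:0, 1:]"])
    moreover have "Im \<in> {f. \<exists>P. \<forall>l. norm l = 1 \<longrightarrow> f l = Re (poly P l)}"
      by (auto intro!: exI[of _ "[:0, - \<i>:]"])
    ultimately show "\<exists>f\<in>{f. \<exists>P. \<forall>l. norm l = 1 \<longrightarrow> f l = Re (poly P l)}. f x \<noteq> f y" by blast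
  qed auto
  show thesis using Stone_Weierstrass_basic[OF assms] that by fastforce
qed

lemma has_integral_Re_poly_circle:
  fixes P :: "complex poly"
  shows "((\<lambda>t. Re (poly P (exp (\<i> * of_real t)))) has_integral 2 * pi * Re (poly P 0)) {0..2*pi}"
proof -
  have "((\<lambda>t. Re (coeff P n * exp (\<i> * of_real t) ^ n)) has_integral
      (if n = 0 then 2 * pi * Re (poly P 0) else 0)) {0..2*pi}" for n
  proof (cases "n = 0")
    case True
    then show ?thesis
      using has_integral_const_real[of "Re (poly P 0)" 0 "2*pi"] by (simp add: poly_0_coeff_0)
  next
    case False
    have "linear (\<lambda>z::complex\<times>complex. Re (fst z))" by (rule linearI) auto
    from has_integral_linear_circle[OF this, of n "(coeff P n, 0)"] False show ?thesis
      by (simp add: cmul_def exp_of_nat_mult[symmetric] algebra_simps)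
  qed
  then have "((\<lambda>t. \<Sum>n\<le>degree P. Re (coeff P n * exp (\<i> * of_real t) ^ n)) has_integral
      (\<Sum>n\<le>degree P. if n = 0 then 2 * pi * Re (poly P 0) else 0)) {0..2*pi}"
    by (intro has_integral_sum) auto
  then show ?thesis by (simp add: poly_altdef)
qed

text \<open>Plurisubharmonicity of \<open>f \<circ> base_proj\<close> on the semitube over \<open>B\<close>.\<close>

definition base_psh_on :: "(complex \<times> real) set \<Rightarrow> (complex \<times> real \<Rightarrow> real) \<Rightarrow> bool" where
  "base_psh_on B f \<longleftrightarrow> continuous_on B f \<and>
     (\<forall>x b. (\<forall>c. norm c \<le> 1 \<longrightarrow> x + base_proj (cmul c b) \<in> B) \<longrightarrow>
        2 * pi * f x \<le> integral {0..2*pi} (\<lambda>t. f (x + base_proj (cmul (exp (\<i> * of_real t)) b))))"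

lemma base_psh_onD:
  assumes "base_psh_on B f" "\<And>c. norm c \<le> 1 \<Longrightarrow> x + base_proj (cmul c b) \<in> B"
  shows "2 * pi * f x \<le> integral {0..2*pi} (\<lambda>t. f (x + base_proj (cmul (exp (\<i> * of_real t)) b)))"
  using assms unfolding base_psh_on_def by blast

lemma circle_integrable:
  fixes f :: "complex \<times> real \<Rightarrow> real"
  assumes "continuous_on B f" "\<And>c. norm c = 1 \<Longrightarrow> x + base_proj (cmul c b) \<in> B"
  shows "(\<lambda>t. f (x + base_proj (cmul (exp (\<i> * of_real t)) b))) integrable_on {0..2*pi}"
  by (rule integrable_continuous_real, rule continuous_on_compose2[OF assms(1)])
    (use assms(2) in \<open>auto intro!: continuous_intros\<close>)

section \<open>Plurisubharmonic functions on the base and an exhaustion\<close>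

lemma base_psh_on_max:
  assumes "base_psh_on B f" "base_psh_on B g"
  shows "base_psh_on B (\<lambda>x. max (f x) (g x))"
  unfolding base_psh_on_def
proof (intro conjI allI impI)
  have cont: "continuous_on B f" "continuous_on B g" using assms by (auto simp: base_psh_on_def)
  then show contm: "continuous_on B (\<lambda>x. max (f x) (g x))" by (intro continuous_intros)
  fix x b assume disc: "\<forall>c. norm c \<le> 1 \<longrightarrow> x + base_proj (cmul c b) \<in> B"
  let ?m = "integral {0..2*pi} (\<lambda>t. max (f (x + base_proj (cmul (exp (\<i> * of_real t)) b)))
      (g (x + base_proj (cmul (exp (\<i> * of_real t)) b))))"
  have "2 * pi * f x \<le> ?m"
    by (rule order_trans[OF base_psh_onD[OF assms(1)]])
      (use disc in \<open>auto intro!: integral_le circle_integrable[OF cont(1)] circle_integrable[OF contm]\<close>)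
  moreover have "2 * pi * g x \<le> ?m"
    by (rule order_trans[OF base_psh_onD[OF assms(2)]])
      (use disc in \<open>auto intro!: integral_le circle_integrable[OF cont(2)] circle_integrable[OF contm]\<close>)
  ultimately show "2 * pi * max (f x) (g x) \<le> ?m" by (simp add: max_def)
qed

lemma has_integral_linear_base_circle:
  fixes L :: "complex \<times> real \<Rightarrow> real"
  assumes "linear L"
  shows "((\<lambda>t. L (base_proj (cmul (exp (\<i> * of_real t)) b))) has_integral 0) {0..2*pi}"
  using has_integral_linear_circle[OF linear_compose[OF linear_base_proj assms], of 1 b]
  by (simp add: o_def)

lemma base_psh_on_norm_square: "base_psh_on B (\<lambda>x. (norm x)\<^sup>2)"
  unfolding base_psh_on_def
proof (intro conjI allI impI)
  show "continuous_on B (\<lambda>x. (norm x)\<^sup>2)" by (intro continuous_intros)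
  fix x b
  let ?p = "\<lambda>t. base_proj (cmul (exp (\<i> * of_real t)) b)"
  have "((\<lambda>t. inner x (?p t)) has_integral 0) {0..2*pi}"
    by (rule has_integral_linear_base_circle) (rule bounded_linear.linear[OF bounded_linear_inner_right])
  then have int: "((\<lambda>t. (norm x)\<^sup>2 + 2 * inner x (?p t)) has_integral (2 * pi * (norm x)\<^sup>2 + 2 * 0)) {0..2*pi}"
    using has_integral_const_real[of "(norm x)\<^sup>2" 0 "2*pi"]
    by (intro has_integral_add has_integral_mult_right) simp_all
  have int': "(\<lambda>t. (norm (x + ?p t))\<^sup>2) integrable_on {0..2*pi}"
    by (intro integrable_continuous_real continuous_intros)
  have "(norm x)\<^sup>2 + 2 * inner x y \<le> (norm (x + y))\<^sup>2" for y
    by (simp add: power2_norm_eq_inner inner_add inner_commute)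
  then have "2 * pi * (norm x)\<^sup>2 + 2 * 0 \<le> integral {0..2*pi} (\<lambda>t. (norm (x + ?p t))\<^sup>2)"
    by (rule has_integral_le[OF int integrable_integral[OF int']])
  then show "2 * pi * (norm x)\<^sup>2 \<le> integral {0..2*pi} (\<lambda>t. (norm (x + ?p t))\<^sup>2)" by simp
qed

text \<open>Approximate the values on the circle by a harmonic polynomial lying above them; the
  comparison on the disc bounds the centre value by the centre value of that polynomial, which is
  its circle mean.\<close>

lemma base_psh_on_minus_ln_infdist:
  assumes psc: "pseudoconvex (semitube B)" and "open B" and ne: "- B \<noteq> {}"
  shows "base_psh_on B (\<lambda>x. - ln (infdist x (- B)))"
  unfolding base_psh_on_def
proof (intro conjI allI impI)
  let ?f = "\<lambda>x. - ln (infdist x (- B))"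
  show cont: "continuous_on B ?f"
    by (intro continuous_intros) (use infdist_Compl_pos[OF \<open>open B\<close> _ ne] in force)
  fix x b assume disc: "\<forall>c. norm c \<le> 1 \<longrightarrow> x + base_proj (cmul c b) \<in> B"
  let ?I = "integral {0..2*pi} (\<lambda>t. ?f (x + base_proj (cmul (exp (\<i> * of_real t)) b)))"
  have int: "(\<lambda>t. ?f (x + base_proj (cmul (exp (\<i> * of_real t)) b))) integrable_on {0..2*pi}"
    by (rule circle_integrable[OF cont]) (use disc in auto)
  have "2 * pi * ?f x \<le> ?I + e" if "e > 0" for e
  proof -
    \<comment> \<open>Raising the approximation by \<open>e'\<close> puts it above the boundary
      values but at most \<open>2 * e'\<close> too high; integrated over the circle this costs
      \<open>4 * pi * e' = e\<close>.\<close>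
    define e' where "e' = e / (4 * pi)"
    have e': "e' > 0" "4 * pi * e' = e" using that by (auto simp: e'_def)
    have "continuous_on (sphere 0 1) (\<lambda>l. ?f (x + base_proj (cmul l b)))"
      by (rule continuous_on_compose2[OF cont]) (use disc in \<open>auto intro!: continuous_intros\<close>)
    then obtain P0 where P0: "\<And>l. norm l = 1 \<Longrightarrow> \<bar>?f (x + base_proj (cmul l b)) - Re (poly P0 l)\<bar> < e'"
      using circle_approx_Re_poly[OF _ e'(1)] by blast
    define P where "P = P0 + [:of_real e':]"
    have P: "Re (poly P l) = Re (poly P0 l) + e'" for l by (simp add: P_def)
    have "?f x \<le> Re (poly P 0)"
    proof (rule minus_ln_infdist_le_Re_poly[OF psc \<open>open B\<close> ne, where b = b])
      fix l :: complex
      show "norm l \<le> 1 \<Longrightarrow> x + base_proj (cmul l b) \<in> B" using disc by blast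
      assume "norm l = 1"
      from P0[OF this] show "?f (x + base_proj (cmul l b)) \<le> Re (poly P l)"
        unfolding P by linarith
    qed
    then have "2 * pi * ?f x \<le> 2 * pi * Re (poly P 0)" by (intro mult_left_mono) auto
    also have "\<dots> \<le> integral {0..2*pi} (\<lambda>t. ?f (x + base_proj (cmul (exp (\<i> * of_real t)) b)) + 2 * e')"
    proof (rule has_integral_le[OF has_integral_Re_poly_circle integrable_integral])
      show "(\<lambda>t. ?f (x + base_proj (cmul (exp (\<i> * of_real t)) b)) + 2 * e') integrable_on {0..2*pi}"
        by (rule integrable_add[OF int integrable_const_ivl])
      show "Re (poly P (exp (\<i> * of_real t))) \<le> ?f (x + base_proj (cmul (exp (\<i> * of_real t)) b)) + 2 * e'" for t
        using P0[of "exp (\<i> * of_real t)"] unfolding P by (simp only: norm_exp_i_times abs_less_iff) linarith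
    qed
    also have "\<dots> = ?I + integral {0..2*pi} (\<lambda>t. 2 * e')"
      by (rule integral_add[OF int integrable_const_ivl])
    also have "\<dots> = ?I + e" using e'(2) by simp
    finally show ?thesis .
  qed
  then show "2 * pi * ?f x \<le> ?I" by (rule field_le_epsilon)
qed

text \<open>The logarithm keeps sublevel sets away from the boundary and the squared norm keeps them
  bounded. The whole space is treated apart, because \<open>infdist\<close> to the empty set is 0 by
  convention and carries no information.\<close>

lemma base_psh_exhaustion:
  assumes psc: "pseudoconvex (semitube B)" and "open B"
  obtains f where "base_psh_on B f" "\<And>M. compact {x \<in> B. f x \<le> M}"
proof (cases "- B = {}")
  case True
  then have B: "B = UNIV" by auto
  have comp: "compact {x \<in> B. (norm x)\<^sup>2 \<le> M}" for M
  proof -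
    have "{x \<in> B. (norm x)\<^sup>2 \<le> M} \<subseteq> cball 0 (sqrt M)"
      using B by (auto simp: real_le_rsqrt)
    then have "bounded {x \<in> B. (norm x)\<^sup>2 \<le> M}" using bounded_cball bounded_subset by blast
    moreover have "closed {x \<in> B. (norm x)\<^sup>2 \<le> M}"
      unfolding B by (auto intro!: closed_Collect_le continuous_intros)
    ultimately show ?thesis by (simp add: compact_eq_bounded_closed)
  qed
  show thesis by (rule that[OF base_psh_on_norm_square comp])
next
  case False
  let ?f = "\<lambda>x. max (- ln (infdist x (- B))) ((norm x)\<^sup>2)"
  have comp: "compact {x \<in> B. ?f x \<le> M}" for M
  proof -
    \<comment> \<open>In this form the condition is closed in the whole space and not merely
      relative to \<open>B\<close>, as compactness requires.\<close>
    have "x \<in> B \<and> - ln (infdist x (- B)) \<le> M \<longleftrightarrow> exp (- M) \<le> infdist x (- B)" for x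
    proof
      assume "x \<in> B \<and> - ln (infdist x (- B)) \<le> M"
      then show "exp (- M) \<le> infdist x (- B)"
        using infdist_Compl_pos[OF \<open>open B\<close> _ False, of x] ln_ge_iff[of "infdist x (- B)" "- M"] by simp
    next
      assume a: "exp (- M) \<le> infdist x (- B)"
      then have "infdist x (- B) > 0" by (rule less_le_trans[OF exp_gt_zero])
      then show "x \<in> B \<and> - ln (infdist x (- B)) \<le> M"
        using a mem_if_dist_less_infdist[of x x B] ln_ge_iff[of "infdist x (- B)" "- M"] by simp
    qed
    then have eq: "{x \<in> B. ?f x \<le> M} = {x. exp (- M) \<le> infdist x (- B)} \<inter> {x. (norm x)\<^sup>2 \<le> M}"
      by auto
    have "{x \<in> B. ?f x \<le> M} \<subseteq> cball 0 (sqrt M)" by (auto simp: real_le_rsqrt)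
    then have "bounded {x \<in> B. ?f x \<le> M}" using bounded_cball bounded_subset by blast
    moreover have "closed {x \<in> B. ?f x \<le> M}"
      unfolding eq by (intro closed_Int closed_Collect_le continuous_intros)
    ultimately show ?thesis by (simp add: compact_eq_bounded_closed)
  qed
  show thesis
    by (rule that[OF base_psh_on_max[OF base_psh_on_minus_ln_infdist[OF assms False]
          base_psh_on_norm_square] comp])
qed

section \<open>Smooth functions and mollification\<close>

lemma Ck_on_Suc_imp: "Ck_on (Suc k) f U \<Longrightarrow> Ck_on k f U"
proof (induction k arbitrary: f)
  case 0
  then show ?case
    by (auto intro!: continuous_at_imp_continuous_on intro: has_derivative_continuous)
next
  case (Suc k)
  then obtain f' where "\<forall>x\<in>U. (f has_derivative f' x) (at x)" "\<And>v. Ck_on (Suc k) (\<lambda>x. f' x v) U"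
    by (auto simp only: Ck_on.simps(2)[of "Suc k"])
  then show ?case using Suc.IH by auto
qed

lemma Ck_on_const: "Ck_on k (\<lambda>x. c) U"
proof (induction k arbitrary: c)
  case (Suc k)
  then show ?case by (auto intro!: exI[of _ "\<lambda>x v. 0"])
qed simp

lemma Ck_on_bounded_linear: "bounded_linear f \<Longrightarrow> Ck_on k f U"
proof (cases k)
  case 0
  then show "bounded_linear f \<Longrightarrow> ?thesis" by (simp add: linear_continuous_on)
next
  case (Suc k')
  assume "bounded_linear f"
  then show ?thesis using Suc
    by (auto intro!: exI[of _ "\<lambda>x. f"] Ck_on_const bounded_linear_imp_has_derivative)
qed

lemma Ck_on_add: "Ck_on k f U \<Longrightarrow> Ck_on k g U \<Longrightarrow> Ck_on k (\<lambda>x. f x + g x) U"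
proof (induction k arbitrary: f g)
  case 0
  then show ?case by (auto intro: continuous_on_add)
next
  case (Suc k)
  obtain f' g' where "\<forall>x\<in>U. (f has_derivative f' x) (at x)" "\<And>v. Ck_on k (\<lambda>x. f' x v) U"
    "\<forall>x\<in>U. (g has_derivative g' x) (at x)" "\<And>v. Ck_on k (\<lambda>x. g' x v) U"
    using Suc.prems by auto
  then show ?case
    by (auto intro!: exI[of _ "\<lambda>x v. f' x v + g' x v"] Suc.IH has_derivative_add)
qed

lemma Ck_on_mult: "Ck_on k f U \<Longrightarrow> Ck_on k g U \<Longrightarrow> Ck_on k (\<lambda>x. f x * g x) U"
proof (induction k arbitrary: f g)
  case 0
  then show ?case by (auto intro: continuous_on_mult)
next
  case (Suc k)
  obtain f' g' where "\<forall>x\<in>U. (f has_derivative f' x) (at x)" "\<And>v. Ck_on k (\<lambda>x. f' x v) U"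
    "\<forall>x\<in>U. (g has_derivative g' x) (at x)" "\<And>v. Ck_on k (\<lambda>x. g' x v) U"
    using Suc.prems by auto
  moreover have "Ck_on k f U" "Ck_on k g U" using Suc.prems by (blast intro: Ck_on_Suc_imp)+
  ultimately show ?case
    by (auto intro!: exI[of _ "\<lambda>x v. f x * g' x v + f' x v * g x"] Ck_on_add Suc.IH has_derivative_mult)
qed

lemma Ck_on_compose_bounded_linear:
  assumes "bounded_linear L" "Ck_on k f UNIV"
  shows "Ck_on k (\<lambda>x. f (L x)) U"
  using assms(2)
proof (induction k arbitrary: f)
  case 0
  then show ?case
    by (auto intro: continuous_on_compose2 linear_continuous_on[OF assms(1)])
next
  case (Suc k)
  then obtain f' where f': "\<And>x. (f has_derivative f' x) (at x)" "\<And>v. Ck_on k (\<lambda>x. f' x v) UNIV"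
    by auto
  have "((\<lambda>x. f (L x)) has_derivative (\<lambda>v. f' (L x) (L v))) (at x)" for x
    by (rule has_derivative_compose[OF bounded_linear_imp_has_derivative[OF assms(1)] f'(1)])
  then show ?case using Suc.IH[OF f'(2)] by (auto intro!: exI[of _ "\<lambda>x v. f' (L x) (L v)"])
qed

section \<open>Bump functions and mollifiers\<close>

text \<open>The classical flat function \<open>exp (- 1 / t)\<close> together with all its multiples
  by powers of \<open>1 / t\<close>. The whole family is taken at once because it is closed under
  differentiation up to linear combinations, so smoothness follows by an induction with
  \<open>n\<close> arbitrary.\<close>

definition exp_inv :: "nat \<Rightarrow> real \<Rightarrow> real" where
  "exp_inv n t = (if t > 0 then inverse t ^ n / exp (inverse t) else 0)"

lemma exp_inv_tendsto_0: "(exp_inv n \<longlongrightarrow> 0) (at 0)"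
proof (rule filterlim_split_at)
  have "((\<lambda>t. inverse t ^ n / exp (inverse t)) \<longlongrightarrow> (0::real)) (at_right 0)"
    by (rule filterlim_compose[OF tendsto_power_div_exp_0 filterlim_inverse_at_top_right])
  moreover have "\<forall>\<^sub>F t in at_right 0. inverse t ^ n / exp (inverse t) = exp_inv n t"
    by (auto simp: eventually_at_filter exp_inv_def)
  ultimately show "(exp_inv n \<longlongrightarrow> 0) (at_right 0)" by (rule Lim_transform_eventually)
  have "\<forall>\<^sub>F t in at_left 0. 0 = exp_inv n t"
    by (auto simp: eventually_at_filter exp_inv_def)
  then show "(exp_inv n \<longlongrightarrow> 0) (at_left 0)" by (rule Lim_transform_eventually[OF tendsto_const])
qed

lemma exp_inv_has_derivative:
  "(exp_inv n has_real_derivative (exp_inv (n + 2) t - real n * exp_inv (n + 1) t)) (at t)"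
proof -
  consider "t > 0" | "t < 0" | "t = 0" by linarith
  then show ?thesis
  proof cases
    case 1
    have "((\<lambda>t. inverse t ^ n * exp (- inverse t)) has_real_derivative
        (exp_inv (n + 2) t - real n * exp_inv (n + 1) t)) (at t)"
    proof (rule DERIV_cong[OF DERIV_chain2[where f = "\<lambda>s. s ^ n * exp (- s)" and g = inverse]])
      show "((\<lambda>s. s ^ n * exp (- s)) has_real_derivative
          real n * inverse t ^ (n - 1) * exp (- inverse t) - inverse t ^ n * exp (- inverse t)) (at (inverse t))"
        by (auto intro!: derivative_eq_intros)
      show "(inverse has_real_derivative - (inverse t ^ Suc (Suc 0))) (at t)"
        using 1 by (intro DERIV_inverse) auto
    qed (use 1 in \<open>cases n; simp add: exp_inv_def exp_minus divide_inverse algebra_simps\<close>)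
    then show ?thesis
      by (rule has_field_derivative_transform_within_open[where S = "{0<..}"])
        (use 1 in \<open>auto simp: exp_inv_def exp_minus divide_inverse\<close>)
  next
    case 2
    have "((\<lambda>t. 0) has_real_derivative (exp_inv (n + 2) t - real n * exp_inv (n + 1) t)) (at t)"
      using 2 by (simp add: exp_inv_def)
    then show ?thesis
      by (rule has_field_derivative_transform_within_open[where S = "{..<0}"])
        (use 2 in \<open>auto simp: exp_inv_def\<close>)
  next
    case 3
    \<comment> \<open>The difference quotient at 0 is the next member of the family, which tends to
      0.\<close>
    have "\<forall>\<^sub>F h in at 0. exp_inv (n + 1) h = (exp_inv n (0 + h) - exp_inv n 0) / h"
      by (auto simp: eventually_at_filter exp_inv_def divide_inverse)
    then have "((\<lambda>h. (exp_inv n (0 + h) - exp_inv n 0) / h) \<longlongrightarrow> 0) (at 0)"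
      by (rule Lim_transform_eventually[OF exp_inv_tendsto_0])
    then show ?thesis using 3 by (simp add: DERIV_def exp_inv_def)
  qed
qed

lemma Ck_on_bump:
  "Ck_on k (\<lambda>x::'a::euclidean_space. exp_inv n (r - inner x x)) U"
proof (induction k arbitrary: n)
  case 0
  have "continuous_on UNIV (exp_inv n)"
    using exp_inv_has_derivative DERIV_isCont continuous_at_imp_continuous_on by blast
  then show ?case by (auto intro!: continuous_on_compose2[of UNIV "exp_inv n"] continuous_intros)
next
  case (Suc k)
  let ?f' = "\<lambda>(x::'a) v. (exp_inv (n + 2) (r - inner x x) - real n * exp_inv (n + 1) (r - inner x x)) * (-2 * inner v x)"
  have "((\<lambda>x. exp_inv n (r - inner x x)) has_derivative ?f' x) (at x)" for x :: 'a
  proof -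
    have "((\<lambda>x::'a. r - inner x x) has_derivative (\<lambda>v. -2 * inner v x)) (at x)"
      by (auto intro!: derivative_eq_intros simp: inner_commute)
    from has_derivative_compose[OF this exp_inv_has_derivative[unfolded has_field_derivative_def]]
    show ?thesis .
  qed
  moreover have "Ck_on k (\<lambda>x. ?f' x v) U" for v
  proof -
    have "Ck_on k (\<lambda>x. (exp_inv (n + 2) (r - inner x x) + (- real n) * exp_inv (n + 1) (r - inner x x)) * (-2 * inner v x)) U"
      by (intro Ck_on_mult Ck_on_add Suc.IH Ck_on_const Ck_on_bounded_linear bounded_linear_inner_right)
    then show ?thesis by simp
  qed
  ultimately show ?case unfolding Ck_on.simps by (intro exI[of _ ?f']) blast
qed

text \<open>Derivatives fall on the kernel, so continuity of \<open>f\<close> suffices. Integration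
  runs over a fixed box, which makes this a parameter integral; the derivative of the kernel is
  packaged as the operator-valued map \<open>D\<close>, continuous because it is so
  componentwise.\<close>

lemma Ck_on_convolution:
  fixes f K :: "'a::euclidean_space \<Rightarrow> real"
  assumes "continuous_on UNIV f" "Ck_on k K UNIV"
  shows "Ck_on k (\<lambda>x. integral (cbox a b) (\<lambda>y. f y * K (x - y))) UNIV"
  using assms(2)
proof (induction k arbitrary: K)
  case 0
  then have "continuous_on (UNIV \<times> cbox a b) (\<lambda>(x, y). f y * K (x - y))"
    by (auto simp: split_beta intro!: continuous_intros continuous_on_compose2[OF assms(1)]
        continuous_on_compose2[of UNIV K])
  then show ?case using integral_continuous_on_param by auto
next
  case (Suc k)
  then obtain K' where K': "\<And>x. (K has_derivative K' x) (at x)" "\<And>v. Ck_on k (\<lambda>x. K' x v) UNIV"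
    by auto
  have contK': "continuous_on UNIV (\<lambda>x. K' x v)" for v
    using K'(2)[of v] by (cases k)
      (auto intro!: continuous_at_imp_continuous_on intro: has_derivative_continuous)
  have contK: "continuous_on UNIV K"
    using K'(1) by (auto intro!: continuous_at_imp_continuous_on has_derivative_continuous)
  define D where "D z = Blinfun (K' z)" for z
  have D: "blinfun_apply (D z) = K' z" for z
    unfolding D_def using K'(1)[of z] by (intro bounded_linear_Blinfun_apply has_derivative_bounded_linear)
  have contD: "continuous_on UNIV D"
    by (rule continuous_on_blinfun_componentwise) (simp add: D contK')
  have contf: "continuous_on S (\<lambda>x. f (g x))" if "continuous_on S g" for S :: "'b::topological_space set" and g
    using that by (auto intro: continuous_on_compose2[OF assms(1)])
  have contD': "continuous_on S (\<lambda>x. D (g x))" if "continuous_on S g" for S :: "'b::topological_space set" and g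
    using that by (auto intro: continuous_on_compose2[OF contD])
  have "((\<lambda>x. integral (cbox a b) (\<lambda>y. f y * K (x - y))) has_derivative
      blinfun_apply (integral (cbox a b) (\<lambda>y. f y *\<^sub>R D (x - y)))) (at x)" for x
  proof (rule leibniz_rule)
    fix x y
    have "((\<lambda>x. K (x - y)) has_derivative (\<lambda>v. K' (x - y) v)) (at x)"
      by (rule has_derivative_compose[of "\<lambda>x. x - y" "\<lambda>v. v", OF _ K'(1)])
        (auto intro!: derivative_eq_intros)
    then show "((\<lambda>x. f y * K (x - y)) has_derivative blinfun_apply (f y *\<^sub>R D (x - y))) (at x)"
      by (auto intro!: derivative_eq_intros simp: D blinfun.scaleR_left)
    show "(\<lambda>y. f y * K (x - y)) integrable_on cbox a b"
      by (auto intro!: integrable_continuous continuous_intros contf continuous_on_compose2[OF contK])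
  next
    show "continuous_on (UNIV \<times> cbox a b) (\<lambda>(x, y). f y *\<^sub>R D (x - y))"
      by (auto simp: split_beta intro!: continuous_intros contf contD')
  qed auto
  moreover have "blinfun_apply (integral (cbox a b) (\<lambda>y. f y *\<^sub>R D (x - y))) v
      = integral (cbox a b) (\<lambda>y. f y * K' (x - y) v)" for x v
    by (subst blinfun_apply_integral)
      (auto intro!: integrable_continuous continuous_intros contf contD' simp: blinfun.scaleR_left D)
  ultimately show ?case using Suc.IH[OF K'(2)]
    by (auto intro!: exI[of _ "\<lambda>x. blinfun_apply (integral (cbox a b) (\<lambda>y. f y *\<^sub>R D (x - y)))"])
qed

lemma mollifier_exists:
  fixes r :: real
  assumes "0 < r" "r \<le> 1"
  obtains K :: "'a::euclidean_space \<Rightarrow> real" where "\<And>k. Ck_on k K UNIV" "\<And>x. K x \<ge> 0"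
    "\<And>x. norm x \<ge> r \<Longrightarrow> K x = 0" "\<And>x. K (- x) = K x" "(K has_integral 1) (cbox (-One) One)"
proof -
  define h :: "'a \<Rightarrow> real" where "h x = exp_inv 0 (r\<^sup>2 - inner x x)" for x
  have nonneg: "h x \<ge> 0" for x by (simp add: h_def exp_inv_def)
  have Ck: "Ck_on k h UNIV" for k unfolding h_def by (rule Ck_on_bump)
  have cont: "continuous_on (cbox (-One) One) h" using Ck[of 0] continuous_on_subset by auto
  have h0: "h 0 > 0" using assms by (simp add: h_def exp_inv_def)
  define I where "I = integral (cbox (-One) One) h"
  have hI: "(h has_integral I) (cbox (-One) One)"
    unfolding I_def by (intro integrable_integral integrable_continuous cont)
  have "I \<noteq> 0"
  proof
    assume "I = 0"
    then have "h 0 = 0"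
      using has_integral_0_cbox_imp_0[OF cont _ hI[unfolded \<open>I = 0\<close>], of 0] nonneg
      by (auto simp: box_ne_empty mem_box)
    then show False using h0 by simp
  qed
  moreover have "I \<ge> 0" using has_integral_nonneg[OF hI] nonneg by simp
  ultimately have "I > 0" by simp
  show thesis
  proof (rule that[of "\<lambda>x. (1 / I) * h x"])
    show "Ck_on k (\<lambda>x. 1 / I * h x) UNIV" for k
      by (intro Ck_on_mult Ck_on_const Ck)
    show "0 \<le> 1 / I * h x" for x using nonneg[of x] \<open>I > 0\<close> by simp
    show "1 / I * h x = 0" if "norm x \<ge> r" for x
    proof -
      have "r\<^sup>2 \<le> inner x x" using power_mono[OF that, of 2] assms by (simp add: power2_norm_eq_inner)
      then show ?thesis by (simp add: h_def exp_inv_def)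
    qed
    show "1 / I * h (- x) = 1 / I * h x" for x by (simp add: h_def)
    show "((\<lambda>x. 1 / I * h x) has_integral 1) (cbox (-One) One)"
      using has_integral_mult_right[OF hI, of "1 / I"] \<open>I > 0\<close> by simp
  qed
qed

lemma norm_le_1_in_cbox: "norm (x::'a::euclidean_space) \<le> 1 \<Longrightarrow> x \<in> cbox (-One) One"
  using Basis_le_norm order_trans by (fastforce simp: mem_box abs_le_iff)

text \<open>Two forms of one convolution: over a large fixed box with the variable in the kernel it
  is visibly smooth, and over the unit cube with the variable in \<open>f\<close> it is visibly an
  average of translates. Evenness of the kernel links them, and the box is large enough to contain
  the unit cube around every \<open>x\<close> of norm at most \<open>R\<close>.\<close>

lemma smoothing:
  fixes f :: "'a::euclidean_space \<Rightarrow> real"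
  assumes contf: "continuous_on UNIV f" and r: "0 < r" "r \<le> 1"
  obtains g K where "smooth_on g UNIV" "continuous_on UNIV K" "\<And>x. K x \<ge> 0"
    "\<And>x. norm x \<ge> r \<Longrightarrow> K x = 0" "(K has_integral 1) (cbox (-One) One)"
    "\<And>x. norm x \<le> R \<Longrightarrow> ((\<lambda>y. f (x + y) * K y) has_integral g x) (cbox (-One) One)"
proof -
  obtain K :: "'a \<Rightarrow> real" where K: "\<And>k. Ck_on k K UNIV" "\<And>x. K x \<ge> 0"
    "\<And>x. norm x \<ge> r \<Longrightarrow> K x = 0" "\<And>x. K (- x) = K x" "(K has_integral 1) (cbox (-One) One)"
    using mollifier_exists[OF r] by metis
  have contK: "continuous_on UNIV K" using K(1)[of 0] by simp
  define a :: 'a where "a = - ((R + 1) *\<^sub>R One)"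
  define b :: 'a where "b = (R + 1) *\<^sub>R One"
  define g where "g x = integral (cbox a b) (\<lambda>y. f y * K (x - y))" for x
  have "((\<lambda>y. f (x + y) * K y) has_integral g x) (cbox (-One) One)" if "norm x \<le> R" for x
  proof -
    have int: "(\<lambda>y. f (x + y) * K y) integrable_on cbox c d" for c d
      by (intro integrable_continuous continuous_intros continuous_on_compose2[OF contf]
          continuous_on_subset[OF contK]) auto
    have Kx: "K (x - y) = K (y - x)" for y using K(4)[of "y - x"] by simp
    have "((\<lambda>y. f y * K (y - x)) has_integral g x) (cbox a b)"
      unfolding g_def Kx
      by (intro integrable_integral integrable_continuous continuous_intros
          continuous_on_subset[OF contf] continuous_on_compose2[OF contK]) auto
    from has_integral_affinity'[OF this, of 1 x]
    have 1: "((\<lambda>y. f (x + y) * K y) has_integral g x) (cbox (a - x) (b - x))"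
      by (simp add: add.commute)
    have "cbox (-One) One \<subseteq> cbox (a - x) (b - x)"
    proof -
      have "\<bar>x \<bullet> i\<bar> \<le> R" if "i \<in> Basis" for i
        using Basis_le_norm[OF that, of x] \<open>norm x \<le> R\<close> by linarith
      then show ?thesis
        unfolding subset_box a_def b_def by (force simp: inner_diff_left abs_le_iff)
    qed
    moreover have "f (x + y) * K y = 0" if "y \<notin> cbox (-One) One" for y
      using norm_le_1_in_cbox[of y] that r K(3)[of y] by fastforce
    ultimately have "((\<lambda>y. f (x + y) * K y) has_integral integral (cbox (-One) One) (\<lambda>y. f (x + y) * K y))
        (cbox (a - x) (b - x))"
      by (intro has_integral_on_superset[OF integrable_integral[OF int]])
    then show ?thesis
      using has_integral_unique[OF 1] integrable_integral[OF int] by metis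
  qed
  moreover have "smooth_on g UNIV"
    unfolding smooth_on_def g_def by (intro allI Ck_on_convolution contf K(1))
  ultimately show thesis using that[of g K] K contK by metis
qed

section \<open>Morse perturbations\<close>

text \<open>Here \<open>f'' v x w\<close> is the second derivative at \<open>x\<close> in the
  directions \<open>v\<close> and \<open>w\<close>, obtained by differentiating directional
  derivatives so that only real-valued functions are differentiated.\<close>

lemma smooth_on_second_derivative:
  assumes "smooth_on f UNIV"
  obtains f' f'' where "\<And>x. (f has_derivative f' x) (at x)"
    "\<And>v x. ((\<lambda>x. f' x v) has_derivative f'' v x) (at x)"
    "\<And>v w. continuous_on UNIV (\<lambda>x. f'' v x w)"
proof -
  have "Ck_on (Suc (Suc 0)) f UNIV" using assms unfolding smooth_on_def by blast
  then obtain f' where f': "\<forall>x. (f has_derivative f' x) (at x)" "\<forall>v. Ck_on (Suc 0) (\<lambda>x. f' x v) UNIV"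
    by (auto simp only: Ck_on.simps(2)[of "Suc 0"])
  have "\<forall>v. \<exists>g. (\<forall>x. ((\<lambda>x. f' x v) has_derivative g x) (at x)) \<and> (\<forall>w. continuous_on UNIV (\<lambda>x. g x w))"
    using f'(2) unfolding Ck_on.simps by simp
  then obtain f'' where "\<forall>v. (\<forall>x. ((\<lambda>x. f' x v) has_derivative f'' v x) (at x)) \<and> (\<forall>w. continuous_on UNIV (\<lambda>x. f'' v x w))"
    by metis
  with f'(1) show thesis using that[of f' f''] by blast
qed

text \<open>The gradient maps a three-dimensional space to itself, and its critical points are the
  points with singular Hessian. Their image is negligible, so a ball contains some \<open>p\<close>
  outside it, and wherever the gradient equals \<open>p\<close> the Hessian is injective.\<close>

lemma Morse_perturbation:
  fixes f' :: "complex \<times> real \<Rightarrow> complex \<times> real \<Rightarrow> real"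
  assumes lin: "\<And>x. linear (f' x)"
    and D2: "\<And>v x. ((\<lambda>x. f' x v) has_derivative f'' v x) (at x)"
    and "e > 0"
  obtains p where "norm p < e"
    "\<And>x w. (\<And>v. f' x v = inner p v) \<Longrightarrow> w \<noteq> 0 \<Longrightarrow> \<exists>v. f'' v x w \<noteq> 0"
proof -
  \<comment> \<open>Linear isometric coordinates, since the rank of the Hessian is read off a
    matrix.\<close>
  define T :: "real^3 \<Rightarrow> complex \<times> real" where "T v = (Complex (v$1) (v$2), v$3)" for v
  define T' :: "complex \<times> real \<Rightarrow> real^3" where "T' x = vector [Re (fst x), Im (fst x), snd x]" for x
  have TT': "T (T' x) = x" for x by (simp add: T_def T'_def)
  have innerT: "inner (T u) (T v) = inner u v" for u v
    by (simp add: T_def inner_prod_def inner_complex_def inner_vec_def sum_3)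
  have linT: "linear T"
    by (rule linearI) (auto simp: T_def complex_eq_iff)
  then have blT: "bounded_linear T" by (simp add: linear_conv_bounded_linear)
  define h :: "real^3 \<Rightarrow> real^3" where "h v = (\<chi> i. f' (T v) (T (axis i 1)))" for v
  define h' :: "real^3 \<Rightarrow> real^3 \<Rightarrow> real^3" where "h' v w = (\<chi> i. f'' (T (axis i 1)) (T v) (T w))" for v w
  have der: "(h has_derivative h' v) (at v)" for v
  proof (subst has_derivative_componentwise_within, intro ballI)
    fix b :: "real^3" assume "b \<in> Basis"
    then obtain i where b: "b = axis i 1" by (auto simp: Basis_vec_def)
    have "((\<lambda>v. f' (T v) (T (axis i 1))) has_derivative (\<lambda>w. f'' (T (axis i 1)) (T v) (T w))) (at v)"
      by (rule has_derivative_compose[OF bounded_linear_imp_has_derivative[OF blT] D2])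
    then show "((\<lambda>x. h x \<bullet> b) has_derivative (\<lambda>x. h' v x \<bullet> b)) (at v)"
      by (simp add: b h_def h'_def inner_axis)
  qed
  define S where "S = {v. rank (matrix (h' v)) < CARD(3)}"
  have "negligible (h ` S)"
    by (rule baby_Sard[where f' = h']) (auto simp: S_def intro: has_derivative_at_withinI der)
  then have "\<not> ball 0 e \<subseteq> h ` S"
    using open_not_negligible[of "ball (0::real^3) e"] \<open>e > 0\<close> negligible_subset by auto
  then obtain y where y: "norm y < e" "y \<notin> h ` S" by (auto simp: subset_iff)
  show thesis
  proof (rule that[of "T y"])
    have "norm (T y) = norm y" using innerT[of y y] by (simp add: norm_eq_sqrt_inner)
    then show "norm (T y) < e" using y by simp
    fix x w :: "complex \<times> real" assume crit: "\<And>v. f' x v = inner (T y) v" and "w \<noteq> 0"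
    have "h (T' x) = y"
      by (simp add: h_def TT' crit innerT inner_axis vec_eq_iff)
    then have "T' x \<notin> S" using y by blast
    then have rk: "\<not> rank (matrix (h' (T' x))) < CARD(3)" by (simp add: S_def)
    have linh: "linear (h' (T' x))" using der has_derivative_linear by blast
    have "inj (\<lambda>w. matrix (h' (T' x)) *v w)"
      using rk less_rank_noninjective by blast
    then have inj: "inj (h' (T' x))" unfolding matrix_vector_mul(2)[OF linh] .
    have "T' w \<noteq> 0" using TT'[of w] \<open>w \<noteq> 0\<close> linear_0[OF linT] by metis
    then have "h' (T' x) (T' w) \<noteq> 0" using inj linear_0[OF linh] by (metis injD)
    then obtain i where "h' (T' x) (T' w) $ i \<noteq> 0" by (auto simp: vec_eq_iff)
    then have "f'' (T (axis i 1)) x w \<noteq> 0" by (simp add: h'_def TT')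
    then show "\<exists>v. f'' v x w \<noteq> 0" by blast
  qed
qed

text \<open>At an accumulation point the derivative \<open>D\<close> of the gradient is injective,
  hence bounded below by some \<open>B\<close>. Another critical point nearby has the same gradient,
  so the first-order error bound with \<open>B / 2\<close> contradicts this.\<close>

lemma finite_nondegenerate_critical_points:
  fixes f' :: "'a::euclidean_space \<Rightarrow> 'a \<Rightarrow> real"
  assumes lin: "\<And>x. linear (f' x)"
    and D2: "\<And>v x. ((\<lambda>x. f' x v) has_derivative f'' v x) (at x)"
    and nondeg: "\<And>x w. (\<And>v. f' x v = inner p v) \<Longrightarrow> w \<noteq> 0 \<Longrightarrow> \<exists>v. f'' v x w \<noteq> 0"
    and "compact K"
  shows "finite {x \<in> K. \<forall>v. f' x v = inner p v}"
proof (rule ccontr)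
  let ?Z = "{x \<in> K. \<forall>v. f' x v = inner p v}"
  assume "infinite ?Z"
  then obtain z where z: "z \<in> K" "z islimpt ?Z"
    using compact_eq_Bolzano_Weierstrass[of K] \<open>compact K\<close> by (metis (no_types, lifting) mem_Collect_eq subsetI)
  have cont: "continuous_on UNIV (\<lambda>x. f' x v)" for v
    using D2 by (auto intro!: continuous_at_imp_continuous_on intro: has_derivative_continuous)
  have "f' z v = inner p v" for v
  proof -
    have "closed {x. f' x v = inner p v}"
      by (intro closed_Collect_eq cont continuous_on_const)
    moreover have "z islimpt {x. f' x v = inner p v}"
      using z(2) by (rule islimpt_subset) auto
    ultimately show ?thesis unfolding closed_limpt by blast
  qed
  then have crit: "f' z v = inner p v" for v by blast
  define G where "G x = (\<Sum>b\<in>Basis. f' x b *\<^sub>R b)" for x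
  define D where "D w = (\<Sum>b\<in>Basis. f'' b z w *\<^sub>R b)" for w
  have der: "(G has_derivative D) (at z)"
    unfolding G_def D_def by (auto intro!: derivative_eq_intros D2)
  have linD: "linear D" using der has_derivative_linear by blast
  have "inj D"
    unfolding linear_inj_iff_eq_0[OF linD]
  proof (intro allI impI, rule ccontr)
    fix w assume "D w = 0" "w \<noteq> 0"
    have zero: "f'' b z w = 0" if "b \<in> Basis" for b
    proof -
      have "inner (D w) b = f'' b z w"
        using that by (simp add: D_def inner_sum_left inner_Basis if_distrib sum.delta' cong: if_cong)
      then show ?thesis using \<open>D w = 0\<close> by simp
    qed
    obtain v where v: "f'' v z w \<noteq> 0" using nondeg[OF crit \<open>w \<noteq> 0\<close>] by blast
    have "f' x v = (\<Sum>b\<in>Basis. inner v b * f' x b)" for x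
      using linear_sum[OF lin, of x "\<lambda>b. inner v b *\<^sub>R b" Basis] euclidean_representation[of v]
      by (simp add: linear_scale[OF lin])
    then have "((\<lambda>x. f' x v) has_derivative (\<lambda>w. \<Sum>b\<in>Basis. inner v b * f'' b z w)) (at z)"
      by (simp, intro has_derivative_sum has_derivative_mult_right D2)
    then have "f'' v z w = (\<Sum>b\<in>Basis. inner v b * f'' b z w)"
      using has_derivative_unique[OF D2] by metis
    then show False using v zero by simp
  qed
  then obtain B where B: "B > 0" "\<And>w. B * norm w \<le> norm (D w)"
    using linear_inj_bounded_below_pos[OF linD] by blast
  obtain d where d: "d > 0" "\<And>x. norm (x - z) < d \<Longrightarrow> norm (G x - G z - D (x - z)) \<le> B / 2 * norm (x - z)"
    using der B(1) unfolding has_derivative_at_alt by (meson half_gt_zero)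
  obtain x where x: "x \<in> ?Z" "x \<noteq> z" "dist x z < d"
    using z(2) d(1) unfolding islimpt_approachable by blast
  have "G x = G z" using x crit by (simp add: G_def)
  then have "norm (D (x - z)) \<le> B / 2 * norm (x - z)" using d(2)[of x] x by (simp add: dist_norm)
  then have "B * norm (x - z) \<le> B / 2 * norm (x - z)" using B(2)[of "x - z"] by linarith
  then show False using B(1) x by simp
qed

section \<open>Smooth strictly plurisubharmonic approximation\<close>

text \<open>Expand to second order on a circle of radius \<open>r\<close>: the first-order and mixed
  terms integrate to 0, the squares of sine and cosine to \<open>pi\<close> each. After division by
  a multiple of \<open>r^2\<close> the sum of the two pure second derivatives remains, up to an
  error \<open>e\<close>.\<close>

lemma circle_submean_imp_laplacian_nonneg:
  fixes f :: "'a::euclidean_space \<Rightarrow> real"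
  assumes D1: "\<And>x. (f has_derivative f' x) (at x)"
    and D2: "\<And>v x. ((\<lambda>x. f' x v) has_derivative f'' v x) (at x)"
    and cont: "\<And>v w. continuous_on UNIV (\<lambda>x. f'' v x w)"
    and "r0 > 0"
    and sub: "\<And>r. 0 < r \<Longrightarrow> r \<le> r0 \<Longrightarrow>
      2 * pi * f x \<le> integral {0..2*pi} (\<lambda>t. f (x + r *\<^sub>R (cos t *\<^sub>R a + sin t *\<^sub>R c)))"
  shows "f'' a x a + f'' c x c \<ge> 0"
proof -
  have lin1: "linear (f' y)" for y using D1 has_derivative_linear by blast
  have lin2: "linear (f'' v y)" for v y using D2 has_derivative_linear by blast
  have add2: "f'' (u + v) y w = f'' u y w + f'' v y w" for u v y w
  proof -
    have "((\<lambda>x. f' x (u + v)) has_derivative (\<lambda>w. f'' u y w + f'' v y w)) (at y)"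
      unfolding linear_add[OF lin1] by (intro has_derivative_add D2)
    then show ?thesis using has_derivative_unique[OF D2] by metis
  qed
  have scale2: "f'' (s *\<^sub>R v) y w = s * f'' v y w" for s v y w
  proof -
    have "((\<lambda>x. f' x (s *\<^sub>R v)) has_derivative (\<lambda>w. s * f'' v y w)) (at y)"
      unfolding linear_scale[OF lin1] real_scaleR_def by (intro has_derivative_mult_right D2)
    then show ?thesis using has_derivative_unique[OF D2] by metis
  qed
  define V where "V t = cos t *\<^sub>R a + sin t *\<^sub>R c" for t
  define q where "q y t = (cos t)\<^sup>2 * f'' a y a + sin t * cos t * (f'' a y c + f'' c y a) + (sin t)\<^sup>2 * f'' c y c" for y t
  have q: "f'' (V t) y (V t) = q y t" for y t
    by (simp add: V_def q_def add2 scale2 linear_add[OF lin2] linear_scale[OF lin2] power2_eq_square algebra_simps)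
  have taylor: "\<exists>s. 0 < s \<and> s < r \<and> f (x + r *\<^sub>R v) = f x + r * f' x v + r\<^sup>2 / 2 * f'' v (x + s *\<^sub>R v) v"
    if "r > 0" for r v
  proof -
    define diff where "diff m t = (if m = 0 then f (x + t *\<^sub>R v) else if m = 1 then f' (x + t *\<^sub>R v) v
        else f'' v (x + t *\<^sub>R v) v)" for m :: nat and t :: real
    have line: "((\<lambda>t. x + t *\<^sub>R v) has_derivative (\<lambda>h. h *\<^sub>R v)) (at t)" for t
      by (auto intro!: derivative_eq_intros)
    have d0: "((\<lambda>t. f (x + t *\<^sub>R v)) has_real_derivative f' (x + t *\<^sub>R v) v) (at t)" for t
      using has_derivative_compose[OF line D1]
      by (simp add: has_field_derivative_def linear_scale[OF lin1] mult.commute[of _ "f' _ _"])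
    have d1: "((\<lambda>t. f' (x + t *\<^sub>R v) v) has_real_derivative f'' v (x + t *\<^sub>R v) v) (at t)" for t
      using has_derivative_compose[OF line D2]
      by (simp add: has_field_derivative_def linear_scale[OF lin2] mult.commute[of _ "f'' _ _ _"])
    have "\<exists>t>0. t < r \<and> f (x + r *\<^sub>R v) = (\<Sum>m<2. diff m 0 / fact m * r ^ m) + diff 2 t / fact 2 * r ^ 2"
    proof (rule Maclaurin[where f = "\<lambda>t. f (x + t *\<^sub>R v)", OF that])
      show "diff 0 = (\<lambda>t. f (x + t *\<^sub>R v))" by (simp add: diff_def fun_eq_iff)
      show "\<forall>m t. m < 2 \<and> 0 \<le> t \<and> t \<le> r \<longrightarrow> (diff m has_real_derivative diff (Suc m) t) (at t)"
        using d0 d1 by (auto simp: diff_def[abs_def] less_2_cases_iff)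
    qed simp
    then show ?thesis by (auto simp: diff_def numeral_2_eq_2 algebra_simps)
  qed
  have "f'' a x a + f'' c x c \<ge> 0 - e" if "e > 0" for e
  proof -
    \<comment> \<open>Continuity costs \<open>e'\<close> on the pure terms and \<open>2 * e'\<close>
      on the mixed ones, rounded up to \<open>4 * e'\<close>; averaged against the factor
      \<open>pi\<close> in front of the pure terms this becomes \<open>8 * e' = e\<close>.\<close>
    define e' where "e' = e / 8"
    have "e' > 0" using that by (simp add: e'_def)
    have "\<exists>d>0. \<forall>y. dist y x < d \<longrightarrow> dist (f'' v y w) (f'' v x w) < e'" for v w
      using cont[of v w] \<open>e' > 0\<close> unfolding continuous_on_iff by (metis UNIV_I)
    then obtain d where d: "\<And>v w. d v w > 0" "\<And>v w y. dist y x < d v w \<Longrightarrow> dist (f'' v y w) (f'' v x w) < e'"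
      by metis
    define \<delta> where "\<delta> = Min {d a a, d a c, d c a, d c c}"
    have \<delta>: "\<delta> > 0" "\<delta> \<le> d a a" "\<delta> \<le> d a c" "\<delta> \<le> d c a" "\<delta> \<le> d c c"
      unfolding \<delta>_def using d(1) by simp_all
    have near: "q y t \<le> q x t + 4 * e'" if "dist y x < \<delta>" for y t
    proof -
      have b: "f'' a y a \<le> f'' a x a + e'" "f'' c y c \<le> f'' c x c + e'"
        "\<bar>(f'' a y c + f'' c y a) - (f'' a x c + f'' c x a)\<bar> \<le> 2 * e'"
        using d(2)[OF less_le_trans[OF that \<delta>(2)]] d(2)[OF less_le_trans[OF that \<delta>(3)]]
          d(2)[OF less_le_trans[OF that \<delta>(4)]] d(2)[OF less_le_trans[OF that \<delta>(5)]]
        unfolding dist_real_def by linarith+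
      have "(cos t)\<^sup>2 * f'' a y a \<le> (cos t)\<^sup>2 * (f'' a x a + e')" "(sin t)\<^sup>2 * f'' c y c \<le> (sin t)\<^sup>2 * (f'' c x c + e')"
        using mult_left_mono[OF b(1), of "(cos t)\<^sup>2"] mult_left_mono[OF b(2), of "(sin t)\<^sup>2"] by simp_all
      moreover have "sin t * cos t * ((f'' a y c + f'' c y a) - (f'' a x c + f'' c x a)) \<le> 1 * (2 * e')"
      proof -
        have "\<bar>sin t * cos t\<bar> \<le> 1"
          unfolding abs_mult using mult_mono[of "\<bar>sin t\<bar>" 1 "\<bar>cos t\<bar>" 1] by simp
        then have "\<bar>sin t * cos t\<bar> * \<bar>(f'' a y c + f'' c y a) - (f'' a x c + f'' c x a)\<bar> \<le> 1 * (2 * e')"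
          using b(3) by (intro mult_mono) auto
        then show ?thesis unfolding abs_mult[symmetric] by linarith
      qed
      moreover have "(cos t)\<^sup>2 * e' + (sin t)\<^sup>2 * e' = e'"
        by (simp flip: distrib_right)
      ultimately show ?thesis using \<open>e' > 0\<close> unfolding q_def distrib_left right_diff_distrib by linarith
    qed
    define N where "N = norm a + norm c + 1"
    have "N > 0" by (simp add: N_def add_nonneg_pos)
    define r where "r = min r0 (\<delta> / (2 * N))"
    have "r > 0" using \<open>r0 > 0\<close> \<delta>(1) \<open>N > 0\<close> by (simp add: r_def)
    have rN: "r * N < \<delta>"
    proof -
      have "r * N \<le> \<delta> / (2 * N) * N" using \<open>N > 0\<close> by (intro mult_right_mono) (auto simp: r_def)
      also have "\<dots> < \<delta>" using \<open>N > 0\<close> \<delta>(1) by simp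
      finally show ?thesis .
    qed
    have V: "norm (V t) \<le> N" for t
    proof -
      have "norm (V t) \<le> \<bar>cos t\<bar> * norm a + \<bar>sin t\<bar> * norm c"
        using norm_triangle_ineq[of "cos t *\<^sub>R a" "sin t *\<^sub>R c"] by (simp add: V_def)
      also have "\<dots> \<le> 1 * norm a + 1 * norm c" by (intro add_mono mult_right_mono) auto
      finally show ?thesis by (simp add: N_def)
    qed
    have upper: "f (x + r *\<^sub>R V t) \<le> f x + r * (cos t * f' x a + sin t * f' x c) + r\<^sup>2 / 2 * (q x t + 4 * e')" for t
    proof -
      obtain s where s: "0 < s" "s < r" "f (x + r *\<^sub>R V t) = f x + r * f' x (V t) + r\<^sup>2 / 2 * f'' (V t) (x + s *\<^sub>R V t) (V t)"
        using taylor[OF \<open>r > 0\<close>] by blast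
      have "s * norm (V t) \<le> r * N" using s V \<open>r > 0\<close> by (intro mult_mono) auto
      then have "dist (x + s *\<^sub>R V t) x < \<delta>" using rN s by (simp add: dist_norm)
      then have "f'' (V t) (x + s *\<^sub>R V t) (V t) \<le> q x t + 4 * e'" unfolding q by (rule near)
      then have "r\<^sup>2 / 2 * f'' (V t) (x + s *\<^sub>R V t) (V t) \<le> r\<^sup>2 / 2 * (q x t + 4 * e')"
        by (intro mult_left_mono) auto
      moreover have "f' x (V t) = cos t * f' x a + sin t * f' x c"
        by (simp add: V_def linear_add[OF lin1] linear_scale[OF lin1])
      ultimately show ?thesis using s(3) by simp
    qed
    have cosq: "((\<lambda>t. (cos t)\<^sup>2) has_integral pi) {0..2*pi}"
      and sinq: "((\<lambda>t. (sin t)\<^sup>2) has_integral pi) {0..2*pi}"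
      and sincos: "((\<lambda>t. sin t * cos t) has_integral 0) {0..2*pi}"
    proof -
      have "((\<lambda>t. (1 + cos (2 * t)) / 2) has_integral ((2 * pi + 0) / 2)) {0..2*pi}"
        using has_integral_cos_multiple[of 2] has_integral_const_real[of "1::real" 0 "2*pi"]
        by (intro has_integral_divide has_integral_add) auto
      moreover have "(1 + cos (2 * t)) / 2 = (cos t)\<^sup>2" for t :: real by (simp add: cos_double_cos)
      ultimately show "((\<lambda>t. (cos t)\<^sup>2) has_integral pi) {0..2*pi}" by simp
      have "((\<lambda>t. (1 - cos (2 * t)) / 2) has_integral ((2 * pi - 0) / 2)) {0..2*pi}"
        using has_integral_cos_multiple[of 2] has_integral_const_real[of "1::real" 0 "2*pi"]
        by (intro has_integral_divide has_integral_diff) auto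
      moreover have "(1 - cos (2 * t)) / 2 = (sin t)\<^sup>2" for t :: real by (simp add: cos_double_sin)
      ultimately show "((\<lambda>t. (sin t)\<^sup>2) has_integral pi) {0..2*pi}" by simp
      have "((\<lambda>t. sin (2 * t) / 2) has_integral (0 / 2)) {0..2*pi}"
        using has_integral_sin_multiple[of 2] by (intro has_integral_divide) auto
      then show "((\<lambda>t. sin t * cos t) has_integral 0) {0..2*pi}" by (simp add: sin_double)
    qed
    have c1: "((\<lambda>t. cos t) has_integral 0) {0..2*pi}" and s1: "((\<lambda>t. sin t) has_integral 0) {0..2*pi}"
      using has_integral_cos_multiple[of 1] has_integral_sin_multiple[of 1] by auto
    have konst: "((\<lambda>t. k) has_integral 2 * pi * k) {0..2*pi}" for k :: real
      using has_integral_const_real[of k 0 "2*pi"] by simp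
    have I: "((\<lambda>t. f x + r * (cos t * f' x a + sin t * f' x c) + r\<^sup>2 / 2 * (q x t + 4 * e')) has_integral
        (2 * pi * f x + r * (0 * f' x a + 0 * f' x c) + r\<^sup>2 / 2 * ((pi * f'' a x a
          + 0 * (f'' a x c + f'' c x a) + pi * f'' c x c) + 2 * pi * (4 * e')))) {0..2*pi}"
      unfolding q_def
      by (rule has_integral_add[OF has_integral_add[OF konst has_integral_mult_right[OF
              has_integral_add[OF has_integral_mult_left[OF c1] has_integral_mult_left[OF s1]]]]
            has_integral_mult_right[OF has_integral_add[OF has_integral_add[OF has_integral_add[OF
              has_integral_mult_left[OF cosq] has_integral_mult_left[OF sincos]]
              has_integral_mult_left[OF sinq]] konst]]])
    have contf: "continuous_on UNIV f"
      using D1 by (auto intro!: continuous_at_imp_continuous_on intro: has_derivative_continuous)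
    have int: "(\<lambda>t. f (x + r *\<^sub>R V t)) integrable_on {0..2*pi}"
      unfolding V_def
      by (intro integrable_continuous_real continuous_on_compose2[OF contf] continuous_intros) auto
    have "2 * pi * f x \<le> integral {0..2*pi} (\<lambda>t. f (x + r *\<^sub>R V t))"
      unfolding V_def using \<open>r > 0\<close> by (intro sub) (auto simp: r_def)
    also have "\<dots> \<le> 2 * pi * f x + r * (0 * f' x a + 0 * f' x c) + r\<^sup>2 / 2 * ((pi * f'' a x a
          + 0 * (f'' a x c + f'' c x a) + pi * f'' c x c) + 2 * pi * (4 * e'))"
      using has_integral_le[OF integrable_integral[OF int] I upper] .
    finally have nonneg: "0 \<le> r\<^sup>2 / 2 * ((pi * f'' a x a + 0 * (f'' a x c + f'' c x a) + pi * f'' c x c)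
        + 2 * pi * (4 * e'))"
      by simp
    have "(pi * f'' a x a + 0 * (f'' a x c + f'' c x a) + pi * f'' c x c) + 2 * pi * (4 * e')
        = pi * (f'' a x a + f'' c x c + 8 * e')"
      by (simp add: distrib_left)
    with nonneg have "0 \<le> (r\<^sup>2 / 2 * pi) * (f'' a x a + f'' c x c + 8 * e')" by (simp only: mult.assoc)
    moreover have "r\<^sup>2 / 2 * pi > 0" using \<open>r > 0\<close> by simp
    ultimately have "0 \<le> f'' a x a + f'' c x c + 8 * e'"
      using mult_pos_neg not_le by blast
    then show ?thesis by (simp add: e'_def)
  qed
  then have "0 \<le> f'' a x a + f'' c x c + e" if "e > 0" for e
    unfolding diff_le_eq using that .
  then show ?thesis by (rule field_le_epsilon)
qed

text \<open>Interchange the circle integral with the convolution: the inequality for each translate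
  is multiplied by a nonnegative weight, and outside the support of \<open>K\<close> both sides
  vanish.\<close>

lemma smoothing_submean:
  fixes F g K :: "complex \<times> real \<Rightarrow> real"
  assumes contF: "continuous_on UNIV F" and contK: "continuous_on UNIV K" and K0: "\<And>y. K y \<ge> 0"
    and supp: "\<And>y. norm y \<ge> r \<Longrightarrow> K y = 0"
    and g: "\<And>x. norm x \<le> R \<Longrightarrow> ((\<lambda>y. F (x + y) * K y) has_integral g x) (cbox (-One) One)"
    and disc: "\<And>l. norm l \<le> 1 \<Longrightarrow> norm (x + base_proj (cmul l w)) \<le> R"
    and sub: "\<And>y. norm y < r \<Longrightarrow>
      2 * pi * F (x + y) \<le> integral {0..2*pi} (\<lambda>t. F (x + y + base_proj (cmul (exp (\<i> * of_real t)) w)))"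
  shows "2 * pi * g x \<le> integral {0..2*pi} (\<lambda>t. g (x + base_proj (cmul (exp (\<i> * of_real t)) w)))"
proof -
  let ?p = "\<lambda>t. base_proj (cmul (exp (\<i> * of_real t)) w)"
  let ?C = "cbox (-One) One :: (complex \<times> real) set"
  have contF': "continuous_on S (\<lambda>x. F (h x))" if "continuous_on S h" for S :: "'b::topological_space set" and h
    using that by (auto intro: continuous_on_compose2[OF contF])
  have contK': "continuous_on S (\<lambda>x. K (h x))" if "continuous_on S h" for S :: "'b::topological_space set" and h
    using that by (auto intro: continuous_on_compose2[OF contK])
  have gx: "((\<lambda>y. F (x + y) * K y) has_integral g x) ?C"
    using g[of x] disc[of 0] by simp
  have cont2: "continuous_on (cbox (-One, 0) (One, 2*pi)) (\<lambda>(y, t). F (x + y + ?p t) * K y)"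
    by (auto simp: split_beta intro!: continuous_intros contF' contK')
  have eq: "integral {0..2*pi} (\<lambda>t. g (x + ?p t)) = integral {0..2*pi} (\<lambda>t. integral ?C (\<lambda>y. F (x + y + ?p t) * K y))"
  proof (rule integral_cong)
    fix t
    have "((\<lambda>y. F (x + ?p t + y) * K y) has_integral g (x + ?p t)) ?C"
      using disc[of "exp (\<i> * of_real t)"] by (intro g) auto
    then show "g (x + ?p t) = integral ?C (\<lambda>y. F (x + y + ?p t) * K y)"
      by (simp add: integral_unique add.assoc add.commute[of "?p t"])
  qed
  also have "\<dots> = integral ?C (\<lambda>y. integral {0..2*pi} (\<lambda>t. F (x + y + ?p t) * K y))"
    using integral_swap_continuous[OF cont2] by simp
  finally have swap: "integral {0..2*pi} (\<lambda>t. g (x + ?p t)) = integral ?C (\<lambda>y. integral {0..2*pi} (\<lambda>t. F (x + y + ?p t) * K y))" .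
  have int: "(\<lambda>y. integral {0..2*pi} (\<lambda>t. F (x + y + ?p t) * K y)) integrable_on ?C"
  proof (rule integrable_continuous)
    have "continuous_on (?C \<times> cbox 0 (2*pi)) (\<lambda>(y, t). F (x + y + ?p t) * K y)"
      using cont2 by (simp add: cbox_Pair_eq)
    from integral_continuous_on_param[OF this]
    show "continuous_on ?C (\<lambda>y. integral {0..2*pi} (\<lambda>t. F (x + y + ?p t) * K y))" by simp
  qed
  have "2 * pi * g x \<le> integral ?C (\<lambda>y. integral {0..2*pi} (\<lambda>t. F (x + y + ?p t) * K y))"
  proof (rule has_integral_le[OF has_integral_mult_right[OF gx] integrable_integral[OF int]])
    fix y
    show "2 * pi * (F (x + y) * K y) \<le> integral {0..2*pi} (\<lambda>t. F (x + y + ?p t) * K y)"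
    proof (cases "norm y < r")
      case True
      from mult_right_mono[OF sub[OF True] K0[of y]] show ?thesis by (simp add: mult.assoc)
    next
      case False
      then show ?thesis using supp[of y] by simp
    qed
  qed
  then show ?thesis using swap by simp
qed

text \<open>Convolution needs a function on the whole space. Inside \<open>B\<close> this is the
  minimum with \<open>M\<close>, off the compact sublevel set it is constant, and these two open
  sets cover everything.\<close>

lemma continuous_on_truncate:
  fixes f :: "'a::t2_space \<Rightarrow> real"
  assumes "open B" "continuous_on B f" "compact {x \<in> B. f x \<le> M}"
  shows "continuous_on UNIV (\<lambda>x. if x \<in> B \<and> f x < M then f x else M)"
proof -
  let ?F = "\<lambda>x. if x \<in> B \<and> f x < M then f x else M"
  have "continuous_on B (\<lambda>x. min (f x) M)" by (intro continuous_intros assms)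
  then have 1: "continuous_on B ?F"
    by (rule continuous_on_eq) (auto simp: min_def)
  have 2: "continuous_on (- {x \<in> B. f x \<le> M}) ?F"
    by (rule continuous_on_eq[OF continuous_on_const]) auto
  have "open (- {x \<in> B. f x \<le> M})"
    using assms(3) compact_imp_closed open_Compl by blast
  then have "continuous_on (B \<union> - {x \<in> B. f x \<le> M}) ?F"
    using 1 2 \<open>open B\<close> by (intro continuous_on_open_Un)
  moreover have "B \<union> - {x \<in> B. f x \<le> M} = UNIV" by auto
  ultimately show ?thesis by simp
qed

lemma mollification_near:
  fixes F K :: "'a::euclidean_space \<Rightarrow> real"
  assumes g: "((\<lambda>y. F (x + y) * K y) has_integral g) S" and K1: "(K has_integral 1) S"
    and K0: "\<And>y. K y \<ge> 0" and supp: "\<And>y. norm y \<ge> r \<Longrightarrow> K y = 0"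
    and near: "\<And>y. norm y < r \<Longrightarrow> \<bar>F (x + y) - F x\<bar> \<le> e"
  shows "\<bar>g - F x\<bar> \<le> e"
proof -
  have b: "F (x + y) * K y \<le> (F x + e) * K y" "(F x - e) * K y \<le> F (x + y) * K y" for y
  proof -
    have "F (x + y) * K y \<le> (F x + e) * K y \<and> (F x - e) * K y \<le> F (x + y) * K y"
    proof (cases "norm y < r")
      case True
      then show ?thesis using near[OF True] by (intro conjI mult_right_mono K0) (auto simp: abs_le_iff)
    next
      case False
      then show ?thesis using supp[of y] by simp
    qed
    then show "F (x + y) * K y \<le> (F x + e) * K y" "(F x - e) * K y \<le> F (x + y) * K y" by auto
  qed
  have "g \<le> (F x + e) * 1"
    by (rule has_integral_le[OF g has_integral_mult_right[OF K1] b(1)])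
  moreover have "(F x - e) * 1 \<le> g"
    by (rule has_integral_le[OF has_integral_mult_right[OF K1] g b(2)])
  ultimately show ?thesis by (simp add: abs_le_iff)
qed

text \<open>The submean inequality holds for \<open>\<phi>\<close> but not for its truncation
  \<open>F\<close>. By uniform continuity, small moves from a point with
  \<open>\<phi> \<le> c\<close> keep \<open>F\<close> below the cut-off, where both agree; the
  averages that enter the mollification there see only \<open>\<phi>\<close>.\<close>

lemma smooth_strictly_psh_approx:
  fixes \<phi> :: "complex \<times> real \<Rightarrow> real"
  assumes "open B" and psh: "base_psh_on B \<phi>" and comp: "\<And>M. compact {x \<in> B. \<phi> x \<le> M}"
  obtains f f' f'' where "smooth_on f UNIV" "\<And>x. (f has_derivative f' x) (at x)"
    "\<And>v x. ((\<lambda>x. f' x v) has_derivative f'' v x) (at x)"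
    "\<And>x. x \<in> B \<Longrightarrow> \<phi> x \<le> c \<Longrightarrow> \<bar>f x - \<phi> x\<bar> < 1/4"
    "\<And>x w. x \<in> B \<Longrightarrow> \<phi> x \<le> c \<Longrightarrow> w \<noteq> 0 \<Longrightarrow>
      f'' (base_proj w) x (base_proj w) + f'' (base_proj (cmul \<i> w)) x (base_proj (cmul \<i> w)) > 0"
proof -
  define M where "M = c + 1"
  define F where "F = (\<lambda>x. if x \<in> B \<and> \<phi> x < M then \<phi> x else M)"
  have cont\<phi>: "continuous_on B \<phi>" using psh by (simp add: base_psh_on_def)
  have contF: "continuous_on UNIV F"
    unfolding F_def by (rule continuous_on_truncate[OF \<open>open B\<close> cont\<phi> comp])
  have F\<phi>: "F x = \<phi> x" if "x \<in> B" "\<phi> x \<le> c" for x using that by (simp add: F_def M_def)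
  have FM: "x \<in> B" "F x = \<phi> x" if "F x < M" for x using that by (auto simp: F_def split: if_splits)
  have "bounded {x \<in> B. \<phi> x \<le> c}" using comp compact_imp_bounded by blast
  then obtain R0 where R0: "R0 > 0" "\<And>x. x \<in> B \<Longrightarrow> \<phi> x \<le> c \<Longrightarrow> norm x \<le> R0"
    unfolding bounded_pos by blast
  \<comment> \<open>The margin 1 leaves room for discs around \<open>x\<close>, and
    \<open>R + 1\<close> for a further translation by the mollifier.\<close>
  define R where "R = R0 + 1"
  have "uniformly_continuous_on (cball 0 (R + 1)) F"
    using contF by (intro compact_uniformly_continuous) (auto intro: continuous_on_subset)
  then have "\<exists>d>0. \<forall>x\<in>cball 0 (R + 1). \<forall>y\<in>cball 0 (R + 1). dist y x < d \<longrightarrow> dist (F y) (F x) < 1/8"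
    unfolding uniformly_continuous_on_def by (metis zero_less_divide_1_iff zero_less_numeral)
  then obtain d where d: "d > 0" "\<And>x y. norm x \<le> R + 1 \<Longrightarrow> norm y \<le> R + 1 \<Longrightarrow> dist y x < d \<Longrightarrow> \<bar>F y - F x\<bar> < 1/8"
    by (auto simp: dist_real_def)
  \<comment> \<open>A translation shorter than \<open>r\<close> followed by a disc of radius at most
    \<open>r\<close> moves a point by less than \<open>d\<close>.\<close>
  define r where "r = min 1 (d / 2)"
  have r: "0 < r" "r \<le> 1" "r \<le> d / 2" using d(1) by (auto simp: r_def)
  obtain g K where g: "smooth_on g UNIV" and contK: "continuous_on UNIV K" and K0: "\<And>x. K x \<ge> 0"
    and supp: "\<And>x. norm x \<ge> r \<Longrightarrow> K x = 0" and K1: "(K has_integral 1) (cbox (-One) One)"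
    and gint: "\<And>x. norm x \<le> R \<Longrightarrow> ((\<lambda>y. F (x + y) * K y) has_integral g x) (cbox (-One) One)"
    using smoothing[OF contF r(1,2), of R] by blast
  obtain g' g'' where g': "\<And>x. (g has_derivative g' x) (at x)"
    and g'': "\<And>v x. ((\<lambda>x. g' x v) has_derivative g'' v x) (at x)"
    and contg'': "\<And>v w. continuous_on UNIV (\<lambda>x. g'' v x w)"
    using smooth_on_second_derivative[OF g] by blast
  have Fnear: "\<bar>F (x + y) - F x\<bar> < 1/8" if "x \<in> B" "\<phi> x \<le> c" "norm y < d" "norm y \<le> 2" for x y
  proof (rule d(2))
    show "norm x \<le> R + 1" using R0(2)[OF that(1,2)] by (simp add: R_def)
    show "norm (x + y) \<le> R + 1" using R0(2)[OF that(1,2)] norm_triangle_ineq[of x y] that by (simp add: R_def)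
    show "dist (x + y) x < d" using that by (simp add: dist_norm)
  qed
  have gnear: "\<bar>g x - F x\<bar> \<le> 1/8" if "x \<in> B" "\<phi> x \<le> c" for x
  proof (rule mollification_near[OF gint K1 K0 supp])
    show "norm x \<le> R" using R0(2)[OF that] by (simp add: R_def)
    show "\<bar>F (x + y) - F x\<bar> \<le> 1/8" if "norm y < r" for y
      using Fnear[OF \<open>x \<in> B\<close> \<open>\<phi> x \<le> c\<close>, of y] that r d(1) by linarith
  qed
  \<comment> \<open>The quadratic term is at most 1/16 on the relevant set; with the mollification
    error 1/8 the total stays below 1/4.\<close>
  define \<eta> where "\<eta> = 1 / (16 * (R0\<^sup>2 + 1))"
  have \<eta>: "\<eta> > 0" by (simp add: \<eta>_def add_nonneg_pos)
  have \<eta>R: "\<eta> * R0\<^sup>2 \<le> 1/16"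
  proof -
    have "\<eta> * R0\<^sup>2 \<le> \<eta> * (R0\<^sup>2 + 1)" using \<eta> by simp
    also have "\<dots> = 1/16" by (simp add: \<eta>_def add_nonneg_eq_0_iff)
    finally show ?thesis .
  qed
  define f where "f x = g x + \<eta> * inner x x" for x
  define f' where "f' x v = g' x v + 2 * \<eta> * inner v x" for x v
  define f'' where "f'' v x w = g'' v x w + 2 * \<eta> * inner v w" for v x w
  show thesis
  proof (rule that[of f f' f''])
    show "smooth_on f UNIV"
      unfolding smooth_on_def
    proof
      fix k
      have bl: "bounded_linear (\<lambda>x::complex\<times>real. inner i x)" for i by (rule bounded_linear_inner_right)
      have "Ck_on k (\<lambda>x::complex\<times>real. \<Sum>i\<in>I. inner i x * inner i x) UNIV" if "finite I" for I
        using that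
      proof induction
        case empty
        then show ?case by (simp add: Ck_on_const)
      next
        case (insert i I)
        then show ?case by (simp add: Ck_on_add Ck_on_mult Ck_on_bounded_linear[OF bl])
      qed
      from this[OF finite_Basis]
      have "Ck_on k (\<lambda>x::complex\<times>real. inner x x) UNIV"
        by (simp add: euclidean_inner[of x x for x] inner_commute)
      then have "Ck_on k (\<lambda>x. g x + \<eta> * inner x x) UNIV"
        using g unfolding smooth_on_def by (intro Ck_on_add Ck_on_mult Ck_on_const) auto
      then show "Ck_on k f UNIV" by (simp add: f_def[abs_def])
    qed
    show "(f has_derivative f' x) (at x)" for x
      unfolding f_def f'_def by (auto intro!: derivative_eq_intros g' simp: inner_commute)
    show "((\<lambda>x. f' x v) has_derivative f'' v x) (at x)" for v x
      unfolding f'_def f''_def by (auto intro!: derivative_eq_intros g'')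
    fix x assume x: "x \<in> B" "\<phi> x \<le> c"
    have nx: "norm x \<le> R0" by (rule R0(2)[OF x])
    then have "inner x x \<le> R0\<^sup>2" by (simp add: power2_norm_eq_inner[symmetric] power_mono)
    then have "\<eta> * inner x x \<le> 1/16" using \<eta> \<eta>R by (meson mult_left_mono order_trans less_imp_le)
    moreover have "\<eta> * inner x x \<ge> 0" using \<eta> by simp
    ultimately show "\<bar>f x - \<phi> x\<bar> < 1/4"
      using gnear[OF x] F\<phi>[OF x] unfolding f_def by linarith
    fix w :: "complex \<times> complex" assume "w \<noteq> 0"
    let ?a = "base_proj w" and ?c = "base_proj (cmul \<i> w)"
    define r0 where "r0 = r / (norm w + 1)"
    have "r0 > 0" using r by (simp add: r0_def add_nonneg_pos)
    have "g'' ?a x ?a + g'' ?c x ?c \<ge> 0"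
    proof (rule circle_submean_imp_laplacian_nonneg[OF g' g'' contg'' \<open>r0 > 0\<close>])
      fix s assume s: "0 < s" "s \<le> r0"
      have sw: "norm (base_proj (cmul l (s *\<^sub>R w))) \<le> r" if "norm l \<le> 1" for l
      proof -
        have "norm (base_proj (cmul l (s *\<^sub>R w))) \<le> norm l * (s * norm w)"
          using norm_base_proj_le[of "cmul l (s *\<^sub>R w)"] s by (simp add: norm_cmul)
        also have "\<dots> \<le> 1 * (r0 * (norm w + 1))" using that s \<open>r0 > 0\<close> by (intro mult_mono) auto
        also have "\<dots> = r" by (simp add: r0_def add_nonneg_eq_0_iff)
        finally show ?thesis .
      qed
      have pt: "base_proj (cmul (exp (\<i> * of_real t)) (s *\<^sub>R w)) = s *\<^sub>R (cos t *\<^sub>R ?a + sin t *\<^sub>R ?c)" for t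
      proof -
        have "cmul \<i> (s *\<^sub>R w) = s *\<^sub>R cmul \<i> w"
          by (simp add: cmul_def prod_eq_iff)
        then show ?thesis
          by (simp add: cmul_cis base_proj_add base_proj_scaleR scaleR_add_right mult.commute)
      qed
      have "2 * pi * g x \<le> integral {0..2*pi} (\<lambda>t. g (x + base_proj (cmul (exp (\<i> * of_real t)) (s *\<^sub>R w))))"
      proof (rule smoothing_submean[OF contF contK K0 supp gint])
        fix l :: complex assume "norm l \<le> 1"
        then show "norm (x + base_proj (cmul l (s *\<^sub>R w))) \<le> R"
          using sw[of l] r nx norm_triangle_ineq[of x "base_proj (cmul l (s *\<^sub>R w))"] by (simp add: R_def)
      next
        fix y :: "complex \<times> real" assume y: "norm y < r"
        have disc: "x + y + base_proj (cmul l (s *\<^sub>R w)) \<in> B"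
          "F (x + y + base_proj (cmul l (s *\<^sub>R w))) = \<phi> (x + y + base_proj (cmul l (s *\<^sub>R w)))"
          if "norm l \<le> 1" for l
        proof -
          have "norm (y + base_proj (cmul l (s *\<^sub>R w))) \<le> norm y + norm (base_proj (cmul l (s *\<^sub>R w)))"
            by (rule norm_triangle_ineq)
          then have "norm (y + base_proj (cmul l (s *\<^sub>R w))) < d \<and> norm (y + base_proj (cmul l (s *\<^sub>R w))) \<le> 2"
            using y sw[OF that] r by linarith
          then have "\<bar>F (x + (y + base_proj (cmul l (s *\<^sub>R w)))) - F x\<bar> < 1/8"
            using Fnear[OF x] by blast
          then have "F (x + y + base_proj (cmul l (s *\<^sub>R w))) < M"
            using F\<phi>[OF x] x(2) unfolding M_def add.assoc by linarith
          then show "x + y + base_proj (cmul l (s *\<^sub>R w)) \<in> B"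
            "F (x + y + base_proj (cmul l (s *\<^sub>R w))) = \<phi> (x + y + base_proj (cmul l (s *\<^sub>R w)))"
            using FM by blast+
        qed
        have "2 * pi * \<phi> (x + y) \<le> integral {0..2*pi} (\<lambda>t. \<phi> (x + y + base_proj (cmul (exp (\<i> * of_real t)) (s *\<^sub>R w))))"
          by (rule base_psh_onD[OF psh disc(1)])
        moreover have "F (x + y) = \<phi> (x + y)" using disc(2)[of 0] by simp
        moreover have "F (x + y + base_proj (cmul (exp (\<i> * of_real t)) (s *\<^sub>R w)))
            = \<phi> (x + y + base_proj (cmul (exp (\<i> * of_real t)) (s *\<^sub>R w)))" for t
          by (rule disc(2)) simp
        ultimately show "2 * pi * F (x + y) \<le> integral {0..2*pi} (\<lambda>t. F (x + y + base_proj (cmul (exp (\<i> * of_real t)) (s *\<^sub>R w))))"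
          by simp
      qed
      then show "2 * pi * g x \<le> integral {0..2*pi} (\<lambda>t. g (x + s *\<^sub>R (cos t *\<^sub>R ?a + sin t *\<^sub>R ?c)))"
        unfolding pt .
    qed
    \<comment> \<open>Although \<open>base_proj\<close> forgets the imaginary part of the second
      coordinate, multiplication by \<open>\<i>\<close> turns it into a real part. The two
      projections together see all of \<open>w\<close>, so invariance does not spoil
      strictness.\<close>
    moreover have "inner ?a ?a + inner ?c ?c > 0"
    proof -
      have "inner ?a ?a + inner ?c ?c = 2 * (norm (fst w))\<^sup>2 + (norm (snd w))\<^sup>2"
        unfolding cmod_power2 by (simp add: base_proj_def cmul_def inner_complex_def power2_eq_square)
      moreover have "fst w \<noteq> 0 \<or> snd w \<noteq> 0" using \<open>w \<noteq> 0\<close> by (simp add: prod_eq_iff)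
      ultimately show ?thesis by (auto simp: add_pos_nonneg add_nonneg_pos)
    qed
    then have "2 * \<eta> * (inner ?a ?a + inner ?c ?c) > 0" using \<eta> by simp
    ultimately show "f'' ?a x ?a + f'' ?c x ?c > 0"
      unfolding f''_def distrib_left by linarith
  qed
qed

section \<open>Strongly pseudoconvex sublevel sets\<close>

text \<open>Pick a direction \<open>v\<close> in which \<open>h\<close> decreases throughout a ball
  around \<open>q\<close>. Segments along \<open>v\<close> starting in the sublevel set stay in it
  and end near \<open>q + \<tau> v\<close>, where a whole ball lies below the level; its
  intersection with the ball around \<open>q\<close> is convex and joins the ends.\<close>

lemma sublevel_locally_connected_at_regular_point:
  fixes h :: "'a::euclidean_space \<Rightarrow> real"
  assumes D1: "\<And>x. (h has_derivative h' x) (at x)"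
    and cont: "\<And>v. continuous_on UNIV (\<lambda>x. h' x v)"
    and reg: "h' q v0 \<noteq> 0" and hq: "h q = c" and W: "open W" "q \<in> W"
  obtains N where "open N" "q \<in> N" "N \<subseteq> W"
    "\<And>x y. x \<in> N \<Longrightarrow> y \<in> N \<Longrightarrow> h x < c \<Longrightarrow> h y < c \<Longrightarrow>
      \<exists>T. connected T \<and> T \<subseteq> {z \<in> W. h z < c} \<and> x \<in> T \<and> y \<in> T"
proof -
  have lin: "linear (h' x)" for x using D1 has_derivative_linear by blast
  define v where "v = (if h' q v0 < 0 then v0 else - v0)"
  have v: "h' q v < 0" using reg linear_neg[OF lin, of q v0] by (auto simp: v_def)
  have "open {x. h' x v < 0}" by (intro open_Collect_less cont continuous_on_const)
  then have "open (W \<inter> {x. h' x v < 0})" "q \<in> W \<inter> {x. h' x v < 0}" using W v by auto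
  then obtain e where e: "e > 0" "ball q e \<subseteq> W \<inter> {x. h' x v < 0}"
    using open_contains_ball by blast
  define \<tau> where "\<tau> = e / (2 * (norm v + 1))"
  have nv: "norm v + 1 > 0" by (simp add: add_nonneg_pos)
  have \<tau>: "\<tau> > 0" "\<tau> * norm v < e / 2"
  proof -
    show "\<tau> > 0" using e nv by (simp add: \<tau>_def)
    then have "\<tau> * norm v < \<tau> * (norm v + 1)" by simp
    also have "\<dots> = e / 2" using nv by (simp add: \<tau>_def divide_simps)
    finally show "\<tau> * norm v < e / 2" .
  qed
  have inball: "x + s *\<^sub>R v \<in> ball q e" if "dist q x < e / 2" "0 \<le> s" "s \<le> \<tau>" for x s
  proof -
    have "s * norm v \<le> \<tau> * norm v" using that by (intro mult_right_mono) auto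
    then have "dist x (x + s *\<^sub>R v) < e / 2" using \<tau>(2) that(2) by (simp add: dist_norm)
    then show ?thesis using dist_triangle[of q "x + s *\<^sub>R v" x] that(1) by simp
  qed
  have der: "((\<lambda>s. h (x + s *\<^sub>R v)) has_real_derivative h' (x + s *\<^sub>R v) v) (at s)" for x s
  proof -
    have "((\<lambda>s. x + s *\<^sub>R v) has_derivative (\<lambda>t. t *\<^sub>R v)) (at s)"
      by (auto intro!: derivative_eq_intros)
    from has_derivative_compose[OF this D1] show ?thesis
      by (simp add: has_field_derivative_def linear_scale[OF lin] mult.commute[of _ "h' _ _"])
  qed
  have dec: "h (x + s *\<^sub>R v) < h x" if "dist q x < e / 2" "0 < s" "s \<le> \<tau>" for x s
  proof -
    have "(\<lambda>s. h (x + s *\<^sub>R v)) s < (\<lambda>s. h (x + s *\<^sub>R v)) 0"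
    proof (rule DERIV_neg_imp_decreasing[OF \<open>0 < s\<close>])
      fix u assume "0 \<le> u" "u \<le> s"
      then have "h' (x + u *\<^sub>R v) v < 0" using inball[OF that(1), of u] that(3) e(2) by auto
      then show "\<exists>y. ((\<lambda>s. h (x + s *\<^sub>R v)) has_real_derivative y) (at u) \<and> y < 0"
        using der by blast
    qed
    then show ?thesis by simp
  qed
  have conth: "continuous_on UNIV h"
    by (intro continuous_at_imp_continuous_on ballI has_derivative_continuous[OF D1])
  have "open {x. h x < c}" by (intro open_Collect_less conth continuous_on_const)
  moreover have "q + \<tau> *\<^sub>R v \<in> {x. h x < c}" using dec[of q \<tau>] \<tau>(1) e(1) hq by simp
  ultimately obtain \<sigma> where \<sigma>: "\<sigma> > 0" "ball (q + \<tau> *\<^sub>R v) \<sigma> \<subseteq> {x. h x < c}"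
    using open_contains_ball by blast
  \<comment> \<open>Translation by \<open>\<tau> v\<close> preserves distances, so points within
    \<open>\<sigma>\<close> of \<open>q\<close> end within \<open>\<sigma>\<close> of
    \<open>q + \<tau> v\<close>; the bound \<open>e / 2\<close> keeps the segments inside the ball
    of radius \<open>e\<close>.\<close>
  define N where "N = ball q (min \<sigma> (e / 2))"
  show thesis
  proof (rule that[of N])
    show "open N" "q \<in> N" using \<sigma> e by (auto simp: N_def)
    have "N \<subseteq> ball q e" unfolding N_def using e(1) by (intro subset_ball) linarith
    then show "N \<subseteq> W" using e(2) by blast
    fix x y assume x: "x \<in> N" "h x < c" and y: "y \<in> N" "h y < c"
    let ?seg = "\<lambda>x. (\<lambda>s. x + s *\<^sub>R v) ` {0..\<tau>}"
    have seg: "connected (?seg z)" "?seg z \<subseteq> {z \<in> W. h z < c}" if "z \<in> N" "h z < c" for z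
    proof -
      show "connected (?seg z)" by (intro connected_continuous_image continuous_intros) simp
      show "?seg z \<subseteq> {z \<in> W. h z < c}"
      proof (rule image_subsetI)
        fix s assume s: "s \<in> {0..\<tau>}"
        have dz: "dist q z < e / 2" using that by (simp add: N_def)
        have "z + s *\<^sub>R v \<in> W" using inball[OF dz, of s] s e(2) by auto
        moreover have "h (z + s *\<^sub>R v) < c"
          using dec[OF dz, of s] s that(2) by (cases "s = 0") auto
        ultimately show "z + s *\<^sub>R v \<in> {z \<in> W. h z < c}" by simp
      qed
    qed
    let ?b = "ball (q + \<tau> *\<^sub>R v) \<sigma> \<inter> ball q e"
    have b: "connected ?b" "?b \<subseteq> {z \<in> W. h z < c}"
    proof -
      show "connected ?b" by (intro convex_connected convex_Int convex_ball)
      show "?b \<subseteq> {z \<in> W. h z < c}" using \<sigma>(2) e(2) by blast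
    qed
    have meet: "z + \<tau> *\<^sub>R v \<in> ?seg z \<inter> ?b" if "z \<in> N" for z
    proof -
      have "dist q z < e / 2" "dist q z < \<sigma>" using that by (simp_all add: N_def)
      then have "z + \<tau> *\<^sub>R v \<in> ball q e" using \<tau>(1) by (intro inball) auto
      moreover have "z + \<tau> *\<^sub>R v \<in> ball (q + \<tau> *\<^sub>R v) \<sigma>"
        using \<open>dist q z < \<sigma>\<close> by (simp add: dist_norm)
      moreover have "z + \<tau> *\<^sub>R v \<in> ?seg z" using \<tau>(1) by (intro imageI) simp
      ultimately show ?thesis by blast
    qed
    have "connected (?seg x \<union> ?b)"
      by (rule connected_Un[OF seg(1)[OF x] b(1)]) (use meet[OF x(1)] in blast)
    then have "connected (?seg x \<union> ?b \<union> ?seg y)"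
      by (rule connected_Un[OF _ seg(1)[OF y]]) (use meet[OF y(1)] in blast)
    moreover have "?seg x \<union> ?b \<union> ?seg y \<subseteq> {z \<in> W. h z < c}"
      using seg(2)[OF x] seg(2)[OF y] b(2) by blast
    moreover have "z \<in> ?seg z" for z using \<tau>(1) by (intro image_eqI[of _ _ 0]) simp_all
    then have "x \<in> ?seg x \<union> ?b \<union> ?seg y" "y \<in> ?seg x \<union> ?b \<union> ?seg y" by blast+
    ultimately show "\<exists>T. connected T \<and> T \<subseteq> {z \<in> W. h z < c} \<and> x \<in> T \<and> y \<in> T"
      by (intro exI[of _ "?seg x \<union> ?b \<union> ?seg y"] conjI)
  qed
qed

section \<open>Semitubes over domains and pulled-back derivatives\<close>

lemma open_semitube: "open B \<Longrightarrow> open (semitube B)"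
proof -
  assume "open B"
  then have "open (base_proj -` B)"
    by (rule open_vimage) (rule continuous_on_base_proj[OF continuous_on_id])
  moreover have "base_proj -` B = semitube B" by (auto simp only: semitube_iff)
  ultimately show ?thesis by simp
qed

lemma is_domain_semitube:
  assumes "is_domain B"
  shows "is_domain (semitube B)"
  unfolding is_domain_def
proof (intro conjI)
  show "open (semitube B)" using assms by (intro open_semitube) (simp add: is_domain_def)
  let ?T = "\<lambda>p :: (complex \<times> real) \<times> real. (fst (fst p), Complex (snd (fst p)) (snd p))"
  have "semitube B = ?T ` (B \<times> UNIV)"
  proof (intro equalityI subsetI)
    fix z assume "z \<in> semitube B"
    then have "(base_proj z, Im (snd z)) \<in> B \<times> UNIV" by (simp add: semitube_iff)
    moreover have "z = ?T (base_proj z, Im (snd z))" by (simp add: base_proj_def)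
    ultimately show "z \<in> ?T ` (B \<times> UNIV)" by (rule rev_image_eqI)
  next
    fix z assume "z \<in> ?T ` (B \<times> UNIV)"
    then obtain x y where "x \<in> B" "z = ?T (x, y)" by blast
    then show "z \<in> semitube B" by (simp add: semitube_iff base_proj_def)
  qed
  moreover have "continuous_on (B \<times> UNIV) ?T"
    unfolding Complex_eq by (intro continuous_intros)
  moreover have "connected (B \<times> (UNIV :: real set))"
    using assms unfolding is_domain_def by (intro connected_Times) auto
  ultimately show "connected (semitube B)" by (simp only: connected_continuous_image)
  obtain x where "x \<in> B" using assms unfolding is_domain_def by blast
  then have "base_lift x \<in> semitube B" by (simp add: semitube_iff)
  then show "semitube B \<noteq> {}" by blast
qed

lemma frontier_semitube:
  assumes "open B" "z \<in> frontier (semitube B)"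
  shows "base_proj z \<in> frontier B"
proof -
  have eq: "semitube B = base_proj -` B" by (auto simp only: semitube_iff)
  have cont: "continuous_on UNIV base_proj" by (rule continuous_on_base_proj[OF continuous_on_id])
  have "z \<in> closure (semitube B)" "z \<notin> semitube B"
    using assms(2) open_semitube[OF assms(1)] by (simp_all add: frontier_def interior_open)
  moreover have "closure (semitube B) \<subseteq> base_proj -` closure B"
    unfolding eq by (intro closure_minimal vimage_mono closure_subset closed_vimage cont closed_closure)
  ultimately have "base_proj z \<in> closure B" "base_proj z \<notin> B" unfolding semitube_iff by blast+
  then show ?thesis using assms(1) by (simp add: frontier_def interior_open)
qed

lemma
  fixes h :: "complex \<times> real \<Rightarrow> real"
  assumes D1: "\<And>x. (h has_derivative h' x) (at x)"
    and D2: "\<And>v x. ((\<lambda>x. h' x v) has_derivative h'' v x) (at x)"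
  shows dir1_base_proj: "dir1 (\<lambda>z. h (base_proj z) + c) p w = h' (base_proj p) (base_proj w)"
    and dir2_base_proj: "dir2 (\<lambda>z. h (base_proj z) + c) p w = h'' (base_proj w) (base_proj p) (base_proj w)"
proof -
  let ?x = "base_proj p" and ?v = "base_proj w"
  have lin1: "linear (h' y)" for y using D1 has_derivative_linear by blast
  have lin2: "linear (h'' v y)" for v y using D2 has_derivative_linear by blast
  have line: "((\<lambda>t. ?x + t *\<^sub>R ?v) has_derivative (\<lambda>s. s *\<^sub>R ?v)) (at t)" for t
    by (auto intro!: derivative_eq_intros)
  have d0: "((\<lambda>t. h (?x + t *\<^sub>R ?v)) has_real_derivative h' (?x + t *\<^sub>R ?v) ?v) (at t)" for t
    using has_derivative_compose[OF line D1]
    by (simp add: has_field_derivative_def linear_scale[OF lin1] mult.commute[of _ "h' _ _"])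
  have d1: "((\<lambda>t. h' (?x + t *\<^sub>R ?v) ?v) has_real_derivative h'' ?v (?x + t *\<^sub>R ?v) ?v) (at t)" for t
    using has_derivative_compose[OF line D2]
    by (simp add: has_field_derivative_def linear_scale[OF lin2] mult.commute[of _ "h'' _ _ _"])
  have eq: "(\<lambda>t. h (base_proj (p + t *\<^sub>R w)) + c) = (\<lambda>t. h (?x + t *\<^sub>R ?v) + c)"
    by (simp add: base_proj_add base_proj_scaleR)
  have d0': "((\<lambda>t. h (?x + t *\<^sub>R ?v) + c) has_real_derivative h' (?x + t *\<^sub>R ?v) ?v) (at t)" for t
    using DERIV_add[OF d0 DERIV_const] by simp
  have first: "deriv (\<lambda>t. h (?x + t *\<^sub>R ?v) + c) = (\<lambda>t. h' (?x + t *\<^sub>R ?v) ?v)"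
    using DERIV_imp_deriv[OF d0'] by blast
  show "dir1 (\<lambda>z. h (base_proj z) + c) p w = h' ?x ?v"
    unfolding dir1_def eq first by simp
  show "dir2 (\<lambda>z. h (base_proj z) + c) p w = h'' ?v ?x ?v"
    unfolding dir2_def eq first using DERIV_imp_deriv[OF d1[of 0]] by simp
qed

text \<open>All errors fit in a band of width 1: \<open>h\<close> differs from \<open>\<phi>\<close>
  by less than 1/2 and the level \<open>c'\<close> from \<open>c\<close> by less than 1/4. The last
  conclusion, on connected sets through \<open>x0\<close>, later gives both nesting and
  covering.\<close>

lemma strongly_pseudoconvex_sublevel_component:
  fixes \<phi> :: "complex \<times> real \<Rightarrow> real"
  assumes "open B" and psh: "base_psh_on B \<phi>" and comp: "\<And>M. compact {x \<in> B. \<phi> x \<le> M}"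
    and x0: "x0 \<in> B" "\<phi> x0 < c - 1"
  obtains C where "is_domain C" "x0 \<in> C" "C \<subseteq> {x \<in> B. \<phi> x < c + 1}"
    "strongly_pseudoconvex_smooth (semitube C)"
    "\<And>S. connected S \<Longrightarrow> x0 \<in> S \<Longrightarrow> S \<subseteq> {x \<in> B. \<phi> x < c - 1} \<Longrightarrow> S \<subseteq> C"
proof -
  obtain f f' f'' where smf: "smooth_on f UNIV" and f': "\<And>x. (f has_derivative f' x) (at x)"
    and f'': "\<And>v x. ((\<lambda>x. f' x v) has_derivative f'' v x) (at x)"
    and near: "\<And>x. x \<in> B \<Longrightarrow> \<phi> x \<le> c + 2 \<Longrightarrow> \<bar>f x - \<phi> x\<bar> < 1/4"
    and levi: "\<And>x w. x \<in> B \<Longrightarrow> \<phi> x \<le> c + 2 \<Longrightarrow> w \<noteq> 0 \<Longrightarrow>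
      f'' (base_proj w) x (base_proj w) + f'' (base_proj (cmul \<i> w)) x (base_proj (cmul \<i> w)) > 0"
    using smooth_strictly_psh_approx[OF assms(1-3), of "c + 2"] by blast
  have linf': "linear (f' x)" for x using f' has_derivative_linear by blast
  define K0 where "K0 = {x \<in> B. \<phi> x \<le> c + 2}"
  have "compact K0" unfolding K0_def by (rule comp)
  then obtain R0 where R0: "R0 > 0" "\<And>x. x \<in> K0 \<Longrightarrow> norm x \<le> R0"
    using compact_imp_bounded[of K0] unfolding bounded_pos by blast
  \<comment> \<open>On \<open>K0\<close> the norm is at most \<open>R0\<close>, so the linear term
    is at most 1/4 there.\<close>
  have "1 / (4 * R0) > 0" using R0(1) by simp
  then obtain p where p: "norm p < 1 / (4 * R0)"
    and nondeg: "\<And>x w. (\<And>v. f' x v = inner p v) \<Longrightarrow> w \<noteq> 0 \<Longrightarrow> \<exists>v. f'' v x w \<noteq> 0"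
    using Morse_perturbation[of f' f'' "1 / (4 * R0)", OF linf' f''] by blast
  define Z where "Z = {x \<in> K0. \<forall>v. f' x v = inner p v}"
  have "finite Z"
    unfolding Z_def by (rule finite_nondegenerate_critical_points[OF linf' f'' nondeg \<open>compact K0\<close>])
  define h where "h x = f x - inner p x" for x
  define h' where "h' x v = f' x v - inner p v" for x v
  have D1: "(h has_derivative h' x) (at x)" for x
    unfolding h_def h'_def
    by (intro has_derivative_diff f' bounded_linear_imp_has_derivative bounded_linear_inner_right)
  have D2: "((\<lambda>x. h' x v) has_derivative f'' v x) (at x)" for v x
    using has_derivative_diff[OF f'' has_derivative_const] unfolding h'_def by simp
  have conth': "continuous_on UNIV (\<lambda>x. h' x v)" for v
    by (intro continuous_at_imp_continuous_on ballI has_derivative_continuous[OF D2])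
  have conth: "continuous_on UNIV h"
    by (intro continuous_at_imp_continuous_on ballI has_derivative_continuous[OF D1])
  have hnear: "\<bar>h x - \<phi> x\<bar> < 1/2" if "x \<in> B" "\<phi> x \<le> c + 2" for x
  proof -
    have "\<bar>inner p x\<bar> \<le> norm p * norm x" by (rule Cauchy_Schwarz_ineq2)
    also have "\<dots> \<le> 1 / (4 * R0) * R0"
      using p R0(1) R0(2)[of x] that by (intro mult_mono) (auto simp: K0_def)
    also have "\<dots> = 1/4" using R0(1) by simp
    finally show ?thesis using near[OF that] unfolding h_def by linarith
  qed
  have "infinite {c - 1/4<..<c + 1/4}" by (simp add: infinite_Ioo)
  then have "infinite ({c - 1/4<..<c + 1/4} - h ` Z)" using \<open>finite Z\<close> by simp
  then have "{c - 1/4<..<c + 1/4} - h ` Z \<noteq> {}" by (rule infinite_imp_nonempty)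
  then obtain c' where "c' \<in> {c - 1/4<..<c + 1/4} - h ` Z" by blast
  then have c': "c - 1/4 < c'" "c' < c + 1/4" "c' \<notin> h ` Z" by simp_all
  have cont\<phi>: "continuous_on B \<phi>" using psh by (simp add: base_psh_on_def)
  \<comment> \<open>The approximation is controlled only up to \<open>c + 2\<close>; elsewhere
    \<open>h\<close> may dip below \<open>c'\<close>. Since points of \<open>D\<close> satisfy
    \<open>\<phi> < c + 1\<close>, this restriction creates no extra boundary.\<close>
  define W where "W = {x \<in> B. \<phi> x < c + 2}"
  have "open W"
  proof -
    have "W = B \<inter> \<phi> -` {..<c + 2}" by (auto simp: W_def)
    then show ?thesis using continuous_open_preimage[OF cont\<phi> \<open>open B\<close>] by simp
  qed
  define D where "D = {x \<in> W. h x < c'}"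
  have "open D"
  proof -
    have "D = W \<inter> {x. h x < c'}" by (auto simp: D_def)
    moreover have "open {x. h x < c'}" by (intro open_Collect_less conth continuous_on_const)
    ultimately show ?thesis using \<open>open W\<close> by auto
  qed
  have D_small: "\<phi> x < c + 1" if "x \<in> D" for x
  proof -
    have "x \<in> B" "\<phi> x \<le> c + 2" "h x < c'" using that by (auto simp: D_def W_def)
    then show ?thesis using hnear[of x] c'(2) by linarith
  qed
  have D_large: "x \<in> D" if "x \<in> B" "\<phi> x < c - 1" for x
  proof -
    have "h x < c'" using hnear[of x] c'(1) that by linarith
    then show ?thesis using that by (simp add: D_def W_def)
  qed
  define C where "C = connected_component_set D x0"
  have "x0 \<in> D" using D_large x0 by blast
  have C: "open C" "connected C" "x0 \<in> C" "C \<subseteq> D"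
    using \<open>open D\<close> \<open>x0 \<in> D\<close> by (auto simp: C_def open_connected_component connected_component_subset)
  have maxC: "T \<subseteq> C" if T: "connected T" "T \<subseteq> D" "T \<inter> C \<noteq> {}" for T
  proof -
    obtain y where y: "y \<in> T" "y \<in> C" using T(3) by blast
    have "T \<subseteq> connected_component_set D y"
      using T(1,2) y by (intro connected_component_maximal) auto
    also have "\<dots> = C" using y(2) connected_component_eq unfolding C_def by metis
    finally show ?thesis .
  qed
  have "is_domain C" using C by (auto simp: is_domain_def)
  have front: "q \<in> W" "\<phi> q \<le> c + 1" "h q = c'" if q: "q \<in> frontier C" for q
  proof -
    have qC: "q \<in> closure C" "q \<notin> C" using q C(1) by (auto simp: frontier_def interior_open)
    \<comment> \<open>Being compact, this set is closed in the whole space, so the frontier of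
      \<open>C\<close> cannot reach the boundary of \<open>B\<close>.\<close>
    have "closed {x \<in> B. \<phi> x \<le> c + 1}" using comp compact_imp_closed by blast
    moreover have "C \<subseteq> {x \<in> B. \<phi> x \<le> c + 1}"
    proof
      fix x assume "x \<in> C"
      then have "x \<in> D" using C(4) by blast
      then show "x \<in> {x \<in> B. \<phi> x \<le> c + 1}" using D_small[of x] by (simp add: D_def W_def)
    qed
    ultimately have qB: "q \<in> {x \<in> B. \<phi> x \<le> c + 1}" using qC(1) closure_minimal by blast
    then show "\<phi> q \<le> c + 1" by simp
    show "q \<in> W" using qB by (auto simp: W_def)
    have "closed {x. h x \<le> c'}" by (intro closed_Collect_le conth continuous_on_const)
    moreover have "C \<subseteq> {x. h x \<le> c'}" using C(4) by (auto simp: D_def)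
    ultimately have "h q \<le> c'" using qC(1) closure_minimal by blast
    moreover have "\<not> h q < c'"
    proof
      assume "h q < c'"
      then have "q \<in> D" using \<open>q \<in> W\<close> by (simp add: D_def)
      then obtain e where e: "e > 0" "ball q e \<subseteq> D" using \<open>open D\<close> open_contains_ball by blast
      have "ball q e \<inter> C \<noteq> {}"
        using qC(1) open_Int_closure_eq_empty[OF open_ball, of q e C] centre_in_ball[of q e] e(1) by blast
      then have "ball q e \<subseteq> C" using e(2) by (intro maxC) auto
      then show False using qC(2) centre_in_ball[of q e] e(1) by blast
    qed
    ultimately show "h q = c'" by simp
  qed
  have regular: "\<exists>v. h' q v \<noteq> 0" if "q \<in> frontier C" for q
  proof -
    have "q \<in> K0" using front(1)[OF that] by (auto simp: K0_def W_def)
    moreover have "q \<notin> Z" using front(3)[OF that] c'(3) by blast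
    ultimately show ?thesis by (auto simp: Z_def h'_def)
  qed
  \<comment> \<open>Local joining at a regular point excludes a second component near
    \<open>q\<close>: any nearby point below the level is connected within \<open>D\<close> to a
    point of \<open>C\<close>.\<close>
  have "\<exists>N. open N \<and> q \<in> N \<and> (\<forall>x\<in>N. x \<in> C \<longleftrightarrow> h x < c')" if q: "q \<in> frontier C" for q
  proof -
    obtain v0 where "h' q v0 \<noteq> 0" using regular[OF q] by blast
    then obtain N where N: "open N" "q \<in> N" "N \<subseteq> W"
      "\<And>x y. x \<in> N \<Longrightarrow> y \<in> N \<Longrightarrow> h x < c' \<Longrightarrow> h y < c' \<Longrightarrow>
        \<exists>T. connected T \<and> T \<subseteq> {z \<in> W. h z < c'} \<and> x \<in> T \<and> y \<in> T"
      using sublevel_locally_connected_at_regular_point[OF D1 conth' _ front(3)[OF q] \<open>open W\<close> front(1)[OF q]]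
      by blast
    have "q \<in> closure C" using q by (simp add: frontier_def)
    then have "N \<inter> C \<noteq> {}"
      using N(1,2) open_Int_closure_eq_empty[of N C] by blast
    then obtain y where y: "y \<in> N" "y \<in> C" by blast
    have "h y < c'" using y C(4) by (auto simp: D_def)
    have "x \<in> C" if x: "x \<in> N" "h x < c'" for x
    proof -
      obtain T where T: "connected T" "T \<subseteq> D" "x \<in> T" "y \<in> T"
        using N(4)[OF x(1) y(1) x(2) \<open>h y < c'\<close>] unfolding D_def by blast
      then have "T \<subseteq> C" using y(2) by (intro maxC) auto
      then show ?thesis using T by blast
    qed
    moreover have "h x < c'" if "x \<in> C" for x using that C(4) by (auto simp: D_def)
    ultimately show ?thesis using N(1,2) by blast
  qed
  then have "\<forall>q\<in>frontier C. \<exists>N. open N \<and> q \<in> N \<and> (\<forall>x\<in>N. x \<in> C \<longleftrightarrow> h x < c')" by blast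
  from bchoice[OF this] obtain N where N: "\<And>q. q \<in> frontier C \<Longrightarrow> open (N q)" "\<And>q. q \<in> frontier C \<Longrightarrow> q \<in> N q"
    "\<And>q x. q \<in> frontier C \<Longrightarrow> x \<in> N q \<Longrightarrow> x \<in> C \<longleftrightarrow> h x < c'"
    by blast
  define U where "U = base_proj -` (\<Union>q\<in>frontier C. N q)"
  define \<rho> where "\<rho> = (\<lambda>z. h (base_proj z) + - c')"
  have contp: "continuous_on UNIV base_proj" by (rule continuous_on_base_proj[OF continuous_on_id])
  have spc: "strongly_pseudoconvex_smooth (semitube C)"
    unfolding strongly_pseudoconvex_smooth_def
  proof (intro conjI exI[of _ U] exI[of _ \<rho>] ballI)
    show "is_domain (semitube C)" by (rule is_domain_semitube[OF \<open>is_domain C\<close>])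
    show "open U" unfolding U_def using N(1) by (intro open_vimage contp open_UN) auto
    show "frontier (semitube C) \<subseteq> U"
      using frontier_semitube[OF C(1)] N(2) unfolding U_def by blast
    show "smooth_on \<rho> U"
      unfolding smooth_on_def
    proof
      fix k
      have "Ck_on k f UNIV" using smf unfolding smooth_on_def by blast
      then have "Ck_on k (\<lambda>x. f x + (- 1) * inner p x) UNIV"
        by (rule Ck_on_add[OF _ Ck_on_mult[OF Ck_on_const Ck_on_bounded_linear[OF bounded_linear_inner_right]]])
      then have "Ck_on k h UNIV" by (simp add: h_def[abs_def])
      then show "Ck_on k \<rho> U" unfolding \<rho>_def
        by (intro Ck_on_add Ck_on_const Ck_on_compose_bounded_linear[OF bounded_linear_base_proj])
    qed
    show "semitube C \<inter> U = {z \<in> U. \<rho> z < 0}"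
    proof -
      have "base_proj z \<in> C \<longleftrightarrow> \<rho> z < 0" if "z \<in> U" for z
      proof -
        obtain q where "q \<in> frontier C" "base_proj z \<in> N q" using \<open>z \<in> U\<close> unfolding U_def by blast
        then show ?thesis using N(3)[of q "base_proj z"] by (simp add: \<rho>_def)
      qed
      then show ?thesis by (auto simp only: semitube_iff Int_iff mem_Collect_eq)
    qed
    fix z assume "z \<in> frontier (semitube C)"
    then have q: "base_proj z \<in> frontier C" by (rule frontier_semitube[OF C(1)])
    obtain v where "h' (base_proj z) v \<noteq> 0" using regular[OF q] by blast
    then have "dir1 \<rho> z (base_lift v) \<noteq> 0"
      unfolding \<rho>_def dir1_base_proj[OF D1 D2] by simp
    then show "\<exists>v. dir1 \<rho> z v \<noteq> 0" by blast
    show "\<forall>w. w \<noteq> 0 \<and> dir1 \<rho> z w = 0 \<and> dir1 \<rho> z (cmul \<i> w) = 0 \<longrightarrow> levi_form \<rho> z w > 0"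
    proof (intro allI impI)
      fix w :: "complex \<times> complex"
      assume "w \<noteq> 0 \<and> dir1 \<rho> z w = 0 \<and> dir1 \<rho> z (cmul \<i> w) = 0"
      moreover have "base_proj z \<in> B" "\<phi> (base_proj z) \<le> c + 2"
        using front(1)[OF q] by (auto simp: W_def)
      \<comment> \<open>The subtracted linear function has no second derivative, so the Levi form is
        a quarter of the positive quantity in \<open>levi\<close>.\<close>
      ultimately show "levi_form \<rho> z w > 0"
        unfolding levi_form_def \<rho>_def dir2_base_proj[OF D1 D2] using levi by simp
    qed
  qed
  show thesis
  proof (rule that[OF \<open>is_domain C\<close> C(3) _ spc])
    have "D \<subseteq> B" unfolding D_def W_def by blast
    then show "C \<subseteq> {x \<in> B. \<phi> x < c + 1}" using C(4) D_small by blast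
    fix S assume S: "connected S" "x0 \<in> S" "S \<subseteq> {x \<in> B. \<phi> x < c - 1}"
    have "S \<subseteq> D" using S(3) D_large by blast
    then show "S \<subseteq> C" using S(1,2) C(3) by (intro maxC) blast+
  qed
qed

section \<open>The exhausting sequence\<close>

theorem theorem1p2:
  fixes G :: "(complex \<times> complex) set"
  assumes "is_semitube_domain G" and "pseudoconvex G"
  shows "\<exists>Gs :: nat \<Rightarrow> (complex \<times> complex) set.
           (\<forall>n\<ge>1. is_semitube_domain (Gs n) \<and> strongly_pseudoconvex_smooth (Gs n)
                   \<and> Gs n \<subseteq> Gs (Suc n) \<and> Gs (Suc n) \<subseteq> G)
         \<and> (\<Union>n\<in>{1..}. Gs n) = G"
proof -
  obtain B where B: "is_domain B" and G: "G = semitube B"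
    using assms(1) unfolding is_semitube_domain_def by blast
  have "open B" "connected B" using B by (auto simp: is_domain_def)
  obtain x0 where x0: "x0 \<in> B" using B by (auto simp: is_domain_def)
  obtain \<phi> where psh: "base_psh_on B \<phi>" and comp: "\<And>M. compact {x \<in> B. \<phi> x \<le> M}"
    using base_psh_exhaustion[OF assms(2)[unfolded G] \<open>open B\<close>] by blast
  \<comment> \<open>The spacing 2 gives \<open>c n + 1 = c (Suc n) - 1\<close>, so
    \<open>C n\<close> is itself a connected set to which the maximality of \<open>C (Suc n)\<close>
    applies. The offset 2 puts \<open>x0\<close> below \<open>c 0 - 1\<close>.\<close>
  define c where "c n = \<phi> x0 + 2 + 2 * real n" for n
  have "\<exists>C. is_domain C \<and> x0 \<in> C \<and> C \<subseteq> {x \<in> B. \<phi> x < c n + 1} \<and>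
      strongly_pseudoconvex_smooth (semitube C) \<and>
      (\<forall>S. connected S \<longrightarrow> x0 \<in> S \<longrightarrow> S \<subseteq> {x \<in> B. \<phi> x < c n - 1} \<longrightarrow> S \<subseteq> C)" for n
  proof -
    have "\<phi> x0 < c n - 1" by (simp add: c_def)
    then obtain C where "is_domain C" "x0 \<in> C" "C \<subseteq> {x \<in> B. \<phi> x < c n + 1}"
      "strongly_pseudoconvex_smooth (semitube C)"
      "\<And>S. connected S \<Longrightarrow> x0 \<in> S \<Longrightarrow> S \<subseteq> {x \<in> B. \<phi> x < c n - 1} \<Longrightarrow> S \<subseteq> C"
      using strongly_pseudoconvex_sublevel_component[OF \<open>open B\<close> psh comp x0] by blast
    then show ?thesis by (intro exI[of _ C]) simp
  qed
  then obtain C where "\<forall>n. is_domain (C n) \<and> x0 \<in> C n \<and> C n \<subseteq> {x \<in> B. \<phi> x < c n + 1} \<and>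
      strongly_pseudoconvex_smooth (semitube (C n)) \<and>
      (\<forall>S. connected S \<longrightarrow> x0 \<in> S \<longrightarrow> S \<subseteq> {x \<in> B. \<phi> x < c n - 1} \<longrightarrow> S \<subseteq> C n)"
    using choice[of "\<lambda>n C. is_domain C \<and> x0 \<in> C \<and> C \<subseteq> {x \<in> B. \<phi> x < c n + 1} \<and>
      strongly_pseudoconvex_smooth (semitube C) \<and>
      (\<forall>S. connected S \<longrightarrow> x0 \<in> S \<longrightarrow> S \<subseteq> {x \<in> B. \<phi> x < c n - 1} \<longrightarrow> S \<subseteq> C)"] by blast
  then have C: "\<And>n. is_domain (C n)" "\<And>n. x0 \<in> C n" "\<And>n. C n \<subseteq> {x \<in> B. \<phi> x < c n + 1}"
    "\<And>n. strongly_pseudoconvex_smooth (semitube (C n))"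
    "\<And>n S. connected S \<Longrightarrow> x0 \<in> S \<Longrightarrow> S \<subseteq> {x \<in> B. \<phi> x < c n - 1} \<Longrightarrow> S \<subseteq> C n"
    by blast+
  have CB: "C n \<subseteq> B" for n using C(3)[of n] by blast
  have mono: "C n \<subseteq> C (Suc n)" for n
  proof (rule C(5))
    show "connected (C n)" using C(1) by (simp add: is_domain_def)
    show "x0 \<in> C n" by (rule C(2))
    show "C n \<subseteq> {x \<in> B. \<phi> x < c (Suc n) - 1}" using C(3)[of n] by (auto simp: c_def)
  qed
  have cover: "\<exists>n\<ge>1. x \<in> C n" if x: "x \<in> B" for x
  proof -
    \<comment> \<open>A path from \<open>x0\<close> to \<open>x\<close> is compact, so
      \<open>\<phi>\<close> is bounded on it and it lies in some \<open>C n\<close> as a connected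
      set; knowing that \<open>\<phi> x\<close> is small would not place \<open>x\<close> in the
      right component.\<close>
    have "path_connected B" using \<open>open B\<close> \<open>connected B\<close> by (rule connected_open_path_connected)
    then obtain g where g: "path g" "path_image g \<subseteq> B" "pathstart g = x0" "pathfinish g = x"
      using x0 x unfolding path_connected_def by blast
    have "continuous_on (path_image g) \<phi>"
      using continuous_on_subset[OF _ g(2)] psh unfolding base_psh_on_def by blast
    then have "compact (\<phi> ` path_image g)"
      using compact_path_image[OF g(1)] by (rule compact_continuous_image)
    then have "bdd_above (\<phi> ` path_image g)" by (intro bounded_imp_bdd_above compact_imp_bounded)
    then obtain m where m: "\<And>y. y \<in> path_image g \<Longrightarrow> \<phi> y \<le> m" by (auto simp: bdd_above_def)
    \<comment> \<open>The absolute values make the bound independent of signs and also force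
      \<open>n \<ge> 1\<close>.\<close>
    obtain n where n: "\<bar>m\<bar> + \<bar>\<phi> x0\<bar> < real n" using reals_Archimedean2 by blast
    have "path_image g \<subseteq> C n"
    proof (rule C(5))
      show "connected (path_image g)" using g(1) by (rule connected_path_image)
      show "x0 \<in> path_image g" using pathstart_in_path_image[of g] g(3) by simp
      have "\<phi> y < c n - 1" if "y \<in> path_image g" for y
        using m[OF that] n unfolding c_def by linarith
      then show "path_image g \<subseteq> {x \<in> B. \<phi> x < c n - 1}" using g(2) by blast
    qed
    then have "x \<in> C n" using pathfinish_in_path_image[of g] g(4) by blast
    moreover have "n \<ge> 1" using n by (cases n) auto
    ultimately show ?thesis by blast
  qed
  show ?thesis
  proof (intro exI[of _ "\<lambda>n. semitube (C n)"] conjI allI impI)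
    fix n :: nat
    show "is_semitube_domain (semitube (C n))" using C(1) by (auto simp: is_semitube_domain_def)
    show "strongly_pseudoconvex_smooth (semitube (C n))" by (rule C(4))
    show "semitube (C n) \<subseteq> semitube (C (Suc n))" using mono[of n] by (auto simp only: semitube_iff)
    show "semitube (C (Suc n)) \<subseteq> G" using CB[of "Suc n"] by (auto simp only: G semitube_iff)
  next
    show "(\<Union>n\<in>{1..}. semitube (C n)) = G"
    proof (intro set_eqI iffI)
      fix z assume "z \<in> (\<Union>n\<in>{1..}. semitube (C n))"
      then show "z \<in> G" using CB unfolding G UN_iff semitube_iff by blast
    next
      fix z assume "z \<in> G"
      then show "z \<in> (\<Union>n\<in>{1..}. semitube (C n))" 
        using cover[of "base_proj z"] unfolding G UN_iff semitube_iff by auto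
    qed
  qed
qed

end
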